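(* Suppose that $\Omega\subset\mathbb{C}^d$ is a hyperbolic domain and $U\subset\Omega$ is a subdomain such that, for a given $\lambda\ge1$, every pair of distinct points of $\partial U\cap\partial\Omega$ satisfies the $\lambda$-visibility property with respect to $\mathsf{k}_\Omega$. Then for any open set $W\subset U$ such that $W\Subset(U\cup\partial\Omega)\setminus\overline{\partial U\cap\Omega}$, there exists $C<\infty$ such that $$\mathsf{k}_U(z,w)\le\mathsf{k}_\Omega(z,w)+C\qquad\text{for all } z,w\in W.$$
   Context: For a domain $\Omega\subset\mathbb{C}^d$, $\mathsf{k}_\Omega$ is the Kobayashi (pseudo)distance and $\kappa_\Omega(z;v)$ the Kobayashi--Royden (pseudo)metric; $\Omega$ is hyperbolic if $\mathsf{k}_\Omega$ is a distance. Boundaries and closures of subsets are taken in $\mathbb{C}^d$. $W\Subset A$ means that $\overline W$ is compact and $\overline W\subset A$. Almost-geodesics: for $\lambda\ge1,\kappa\ge0$ and an interval $I\subset\mathbb{R}$, a map $\sigma:I\to\Omega$ is a $(\lambda,\kappa)$-almost-geodesic (for $\mathsf{k}_\Omega$) if (i) $\frac1\lambda|s-t|-\kappa\le \mathsf{k}_\Omega(\sigma(s),\sigma(t))\le\lambda|s-t|+\kappa$ for all $s,t\in I$; (ii) $\sigma$ is absolutely continuous and $\kappa_\Omega(\sigma(t);\sigma'(t))\le\lambda$ for a.e. $t\in I$. Visibility of a pair of boundary points: distinct $\zeta,\eta\in\partial\Omega$ satisfy the $\lambda$-visibility property with respect to $\mathsf{k}_\Omega$ if for every $\kappa>0$ there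 exist neighbourhoods $V_\zeta$, $V_\eta$ of $\zeta,\eta$ in $\overline{\Omega}$ with $\overline{V_\zeta}\cap\overline{V_\eta}=\emptyset$ and a compact $K\subset\Omega$ such that every $(\lambda,\kappa)$-almost-geodesic $\sigma:[0,T]\to\Omega$ for $\mathsf{k}_\Omega$ with $\sigma(0)\in V_\zeta$, $\sigma(T)\in V_\eta$ satisfies $\sigma([0,T])\cap K\ne\emptyset$. *)

theory Defs
  imports "HOL-Complex_Analysis.Complex_Analysis"
begin

text \<open>
  The space \<open>\<complex>\<^sup>d\<close> is rendered as \<^typ>\<open>complex ^ 'n\<close> with \<open>d = CARD('n)\<close>; its norm and topology
  are the Euclidean ones, and \<open>*s\<close> is multiplication by complex scalars.
\<close>

definition cn_domain :: "(complex ^ 'n) set \<Rightarrow> bool" where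
  "cn_domain \<Omega> \<longleftrightarrow> open \<Omega> \<and> connected \<Omega> \<and> \<Omega> \<noteq> {}"

definition analytic_discs :: "(complex ^ 'n) set \<Rightarrow> (complex \<Rightarrow> complex ^ 'n) set" where
  "analytic_discs \<Omega> =
    {\<phi>. (\<forall>i. (\<lambda>\<zeta>. \<phi> \<zeta> $ i) holomorphic_on ball 0 1) \<and> \<phi> ` ball 0 1 \<subseteq> \<Omega>}"

definition disc_deriv :: "(complex \<Rightarrow> complex ^ 'n) \<Rightarrow> complex \<Rightarrow> complex ^ 'n" where
  "disc_deriv \<phi> a = (\<chi> i. deriv (\<lambda>\<zeta>. \<phi> \<zeta> $ i) a)"

text \<open>
  The Poincare distance is the one of the metric \<open>|d\<zeta>| / (1 - |\<zeta>|\<^sup>2)\<close>. With this normalisation the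
  Kobayashi distance is the integrated form of the Kobayashi--Royden metric defined below.
\<close>

definition poincare_dist :: "complex \<Rightarrow> complex \<Rightarrow> real" where
  "poincare_dist a b = artanh (cmod ((a - b) / (1 - cnj b * a)))"

text \<open>
  The Kobayashi pseudodistance is the infimum of the lengths of chains of analytic discs. For a
  domain, every two of its points are joined by a chain, so that the real-valued infimum is taken
  over a nonempty set of nonnegative numbers. The value \<open>0\<close> off \<open>\<Omega>\<close> is a totalisation convention:
  the library's \<^locale>\<open>Metric_space\<close> asks for nonnegativity and symmetry on the whole type.
\<close>

definition kobayashi_dist ::
    "(complex ^ 'n) set \<Rightarrow> complex ^ 'n \<Rightarrow> complex ^ 'n \<Rightarrow> real" where
  "kobayashi_dist \<Omega> z w =
    (if z \<in> \<Omega> \<and> w \<in> \<Omega> then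
       Inf {(\<Sum>j<m. poincare_dist (a j) (b j)) | m a b.
              m \<ge> 1 \<and>
              (\<exists>\<phi> p. p 0 = z \<and> p m = w \<and>
                (\<forall>j<m. \<phi> j \<in> analytic_discs \<Omega> \<and> a j \<in> ball 0 1 \<and> b j \<in> ball 0 1 \<and>
                       \<phi> j (a j) = p j \<and> \<phi> j (b j) = p (Suc j)))}
     else 0)"

text \<open>For a domain \<open>\<Omega>\<close> and \<open>z \<in> \<Omega>\<close> the set below is nonempty, as \<open>\<Omega>\<close> is open.\<close>

definition kobayashi_royden ::
    "(complex ^ 'n) set \<Rightarrow> complex ^ 'n \<Rightarrow> complex ^ 'n \<Rightarrow> real" where
  "kobayashi_royden \<Omega> z v =
    Inf {cmod \<xi> | \<xi>. \<exists>\<phi> \<in> analytic_discs \<Omega>. \<phi> 0 = z \<and> \<xi> *s disc_deriv \<phi> 0 = v}"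

definition kobayashi_hyperbolic :: "(complex ^ 'n) set \<Rightarrow> bool" where
  "kobayashi_hyperbolic \<Omega> \<longleftrightarrow> Metric_space \<Omega> (kobayashi_dist \<Omega>)"

text \<open>
  Absolute continuity of a function (the library's \<^const>\<open>absolutely_continuous\<close> is about measures).
\<close>

definition abs_continuous_on :: "real set \<Rightarrow> (real \<Rightarrow> 'a::metric_space) \<Rightarrow> bool" where
  "abs_continuous_on I \<sigma> \<longleftrightarrow>
    (\<forall>\<epsilon>>0. \<exists>\<delta>>0. \<forall>(m::nat) a b.
       (\<forall>i<m. a i \<le> b i \<and> {a i..b i} \<subseteq> I) \<and>
       disjoint_family_on (\<lambda>i. {a i<..<b i}) {..<m} \<and>
       (\<Sum>i<m. b i - a i) < \<delta>
       \<longrightarrow> (\<Sum>i<m. dist (\<sigma> (a i)) (\<sigma> (b i))) < \<epsilon>)"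

text \<open>
  Here \<open>I\<close> is meant to be an interval. The one-sided derivatives at the end points of \<open>I\<close> are
  irrelevant, since these points form a null set.
\<close>

definition almost_geodesic ::
    "(complex ^ 'n) set \<Rightarrow> real \<Rightarrow> real \<Rightarrow> real set \<Rightarrow> (real \<Rightarrow> complex ^ 'n) \<Rightarrow> bool" where
  "almost_geodesic \<Omega> lam \<kappa> I \<sigma> \<longleftrightarrow>
    \<sigma> ` I \<subseteq> \<Omega> \<and>
    (\<forall>s\<in>I. \<forall>t\<in>I.
       1 / lam * \<bar>s - t\<bar> - \<kappa> \<le> kobayashi_dist \<Omega> (\<sigma> s) (\<sigma> t) \<and>
       kobayashi_dist \<Omega> (\<sigma> s) (\<sigma> t) \<le> lam * \<bar>s - t\<bar> + \<kappa>) \<and>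
    abs_continuous_on I \<sigma> \<and>
    (AE t in lebesgue. t \<in> I \<longrightarrow>
       (\<exists>v. (\<sigma> has_vector_derivative v) (at t within I) \<and> kobayashi_royden \<Omega> (\<sigma> t) v \<le> lam))"

definition visible_pair ::
    "(complex ^ 'n) set \<Rightarrow> real \<Rightarrow> complex ^ 'n \<Rightarrow> complex ^ 'n \<Rightarrow> bool" where
  "visible_pair \<Omega> lam \<zeta> \<eta> \<longleftrightarrow>
    (\<forall>\<kappa>>0. \<exists>V\<^sub>\<zeta> V\<^sub>\<eta> K.
       openin (top_of_set (closure \<Omega>)) V\<^sub>\<zeta> \<and> \<zeta> \<in> V\<^sub>\<zeta> \<and>
       openin (top_of_set (closure \<Omega>)) V\<^sub>\<eta> \<and> \<eta> \<in> V\<^sub>\<eta> \<and>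
       closure V\<^sub>\<zeta> \<inter> closure V\<^sub>\<eta> = {} \<and>
       compact K \<and> K \<subseteq> \<Omega> \<and>
       (\<forall>\<sigma> T. T \<ge> 0 \<and> almost_geodesic \<Omega> lam \<kappa> {0..T} \<sigma> \<and> \<sigma> 0 \<in> V\<^sub>\<zeta> \<and> \<sigma> T \<in> V\<^sub>\<eta>
          \<longrightarrow> \<sigma> ` {0..T} \<inter> K \<noteq> {}))"

end

theory Submission
  imports Defs
begin

text \<open>
  Chains of analytic discs are traversed by curves that are locally radii \<open>\<phi> (tanh h)\<close> of discs, so
  that the Kobayashi distance along them is bounded by the elapsed time. Nearly minimal chains then give
  almost-geodesics without any appeal to Royden's theorem on the infinitesimal metric.

  By visibility and compactness, all such almost-geodesics that start near \<open>W\<close> and leave a fixed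
  neighbourhood of it meet a compact subset of \<open>U\<close>. Hence, for \<open>z\<close> near \<open>W\<close>, the distance from \<open>z\<close> to
  \<open>\<Omega> - U\<close> is bounded below by a positive constant and also by the distance from \<open>z\<close> to a base point, up
  to a constant; along an almost-geodesic parametrised on \<open>[0, T]\<close> it is therefore at least
  \<open>r t = max r\<^sub>0 (\<bar>t - t\<^sub>0\<bar> / 2 - c)\<close>, where \<open>t\<^sub>0\<close> is a time at which the curve is closest to the base
  point. Discs of \<open>\<Omega>\<close> centred on the curve map the disc of radius \<open>tanh (r t)\<close> into \<open>U\<close>, and since
  \<open>coth (r t) - 1\<close> is integrable, the length of the curve in \<open>U\<close> is at most \<open>T\<close> plus a constant. An
  almost-geodesic that leaves the neighbourhood is cut where it meets the compact set, from both ends.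
\<close>

section \<open>Chains of analytic discs\<close>

lemma tanh_artanh_real:
  assumes "\<bar>x::real\<bar> < 1"
  shows "tanh (artanh x) = x"
proof -
  have p: "(1 + x) / (1 - x) > 0" using assms by simp
  have "tanh (ln (sqrt ((1 + x) / (1 - x)))) = x"
    using p assms by (subst tanh_ln_real) (auto simp: field_simps)
  moreover have "ln (sqrt ((1 + x) / (1 - x))) = artanh x"
    using p by (simp add: artanh_def ln_sqrt)
  ultimately show ?thesis by simp
qed

lemma artanh_nonneg:
  assumes "0 \<le> (x::real)" "x < 1"
  shows "0 \<le> artanh x"
  using assms tanh_artanh_real[of x] by (metis abs_of_nonneg tanh_real_nonneg_iff)

lemma analytic_discsD:
  fixes \<phi> :: "complex \<Rightarrow> complex ^ 'n"
  assumes "\<phi> \<in> analytic_discs S"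
  shows "(\<lambda>\<zeta>. \<phi> \<zeta> $ i) holomorphic_on ball 0 1" "cmod \<zeta> < 1 \<Longrightarrow> \<phi> \<zeta> \<in> S"
  using assms by (auto simp: analytic_discs_def)

lemma analytic_discs_const: "z \<in> S \<Longrightarrow> (\<lambda>_. z) \<in> analytic_discs S"
  by (auto simp: analytic_discs_def)

lemma analytic_discs_compose:
  assumes "\<phi> \<in> analytic_discs S" "m holomorphic_on ball 0 1" "m ` ball 0 1 \<subseteq> ball 0 1"
    and "\<And>\<zeta>. cmod \<zeta> < 1 \<Longrightarrow> \<phi> (m \<zeta>) \<in> T"
  shows "(\<lambda>\<zeta>. \<phi> (m \<zeta>)) \<in> analytic_discs T"
proof -
  have "((\<lambda>\<zeta>. \<phi> \<zeta> $ i) \<circ> m) holomorphic_on ball 0 1" for i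
    by (rule holomorphic_on_compose_gen[OF assms(2) analytic_discsD(1)[OF assms(1)] assms(3)])
  then show ?thesis using assms(4) by (auto simp: analytic_discs_def o_def)
qed

lemma analytic_discs_linear:
  assumes "\<And>\<zeta>. cmod \<zeta> < 1 \<Longrightarrow> z + \<zeta> *s v \<in> S"
  shows "(\<lambda>\<zeta>. z + \<zeta> *s v) \<in> analytic_discs S"
  using assms by (auto simp: analytic_discs_def intro!: holomorphic_intros)

lemma norm_scalar_mult_vec: "norm (c *s (v :: complex ^ 'n)) = cmod c * norm v"
  by (simp add: norm_vec_def norm_mult L2_set_right_distrib)

section \<open>The Poincare distance and automorphisms of the unit disc\<close>

lemma cmod_moebius_less_1:
  assumes "cmod a < 1" "cmod b < 1"
  shows "cmod ((a - b) / (1 - cnj b * a)) < 1"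
  using Moebius_function_norm_lt_1[of b a 0] assms by (simp add: Moebius_function_simple)

lemma poincare_dist_nonneg:
  assumes "cmod a < 1" "cmod b < 1"
  shows "0 \<le> poincare_dist a b"
  unfolding poincare_dist_def using cmod_moebius_less_1[OF assms] by (intro artanh_nonneg) auto

lemma poincare_dist_0: "poincare_dist 0 b = artanh (cmod b)" "poincare_dist b 0 = artanh (cmod b)"
  by (auto simp: poincare_dist_def)

text \<open>The inverse of the Moebius map sending \<open>a\<close> to 0 is preceded by the rotation
  that turns the positive axis towards \<open>c\<close>, the image of \<open>b\<close>. The modulus
  of \<open>c\<close> is \<open>tanh\<close> of the Poincare distance.\<close>

lemma disc_automorphism_to_segment:
  assumes "cmod a < 1" "cmod b < 1"
  obtains m where "m holomorphic_on ball 0 1" "m ` ball 0 1 \<subseteq> ball 0 1" "m 0 = a"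
    "m (of_real (tanh (poincare_dist a b))) = b"
proof -
  define c where "c = (b - a) / (1 - cnj a * b)"
  have c1: "cmod c < 1" unfolding c_def by (rule cmod_moebius_less_1[OF assms(2,1)])
  have n: "cmod (1 - cnj a * b) = cmod (1 - cnj b * a)"
    by (metis complex_cnj_cnj complex_cnj_diff complex_cnj_mult complex_cnj_one complex_mod_cnj mult.commute)
  have cm: "cmod c = cmod ((a - b) / (1 - cnj b * a))"
    by (simp add: c_def norm_divide n norm_minus_commute)
  have tn: "tanh (poincare_dist a b) = cmod c"
    unfolding poincare_dist_def cm[symmetric] using c1 by (intro tanh_artanh_real) auto
  obtain u where u: "cmod u = 1" "u * of_real (cmod c) = c"
  proof (cases "c = 0")
    case True then show ?thesis using that[of 1] by auto
  next
    case False then show ?thesis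
      by (intro that[of "c / of_real (cmod c)"]) (auto simp: norm_divide)
  qed
  define m where "m = (\<lambda>\<zeta>. Moebius_function 0 (-a) (u * \<zeta>))"
  have ub: "(\<lambda>\<zeta>. u * \<zeta>) ` ball 0 1 \<subseteq> ball 0 1" using u by (auto simp: norm_mult)
  have "(Moebius_function 0 (-a) \<circ> (\<lambda>\<zeta>. u * \<zeta>)) holomorphic_on ball 0 1"
    using assms ub by (intro holomorphic_on_compose_gen[where t = "ball 0 1"] holomorphic_intros
        Moebius_function_holomorphic) auto
  then have h: "m holomorphic_on ball 0 1" by (simp add: m_def o_def)
  have im: "m ` ball 0 1 \<subseteq> ball 0 1"
    using assms u by (auto simp: m_def norm_mult intro!: Moebius_function_norm_lt_1)
  have m0: "m 0 = a" by (simp add: m_def Moebius_function_simple)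
  have "c = Moebius_function 0 a b" by (simp only: c_def Moebius_function_simple)
  then have "m (of_real (cmod c)) = Moebius_function 0 (-a) (Moebius_function 0 a b)"
    using u(2) m_def by presburger
  also have "\<dots> = b" using assms by (intro Moebius_function_compose) auto
  finally show ?thesis using that h im m0 tn by simp
qed

text \<open>Turns a link of a chain into a radius starting at 0, which can then be run through at
  unit speed.\<close>

lemma normalized_disc:
  assumes "\<phi> \<in> analytic_discs S" "cmod a < 1" "cmod b < 1"
  obtains \<psi> where "\<psi> \<in> analytic_discs S" "\<psi> 0 = \<phi> a"
    "\<psi> (of_real (tanh (poincare_dist a b))) = \<phi> b"
proof -
  obtain m where m: "m holomorphic_on ball 0 1" "m ` ball 0 1 \<subseteq> ball 0 1" "m 0 = a"
    "m (of_real (tanh (poincare_dist a b))) = b"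
    using disc_automorphism_to_segment[OF assms(2,3)] by metis
  have "(\<lambda>\<zeta>. \<phi> (m \<zeta>)) \<in> analytic_discs S"
    using m(2) by (intro analytic_discs_compose[OF assms(1) m(1,2)] analytic_discsD(2)[OF assms(1)])
      (auto simp: image_subset_iff)
  then show ?thesis using that m by simp
qed

text \<open>Chains grow by one disc at the far end, so that rule induction replaces the handling of
  indexed families of points and discs.\<close>

inductive disc_chain :: "(complex ^ 'n) set \<Rightarrow> complex ^ 'n \<Rightarrow> complex ^ 'n \<Rightarrow> real \<Rightarrow> bool"
  for S z where
  nil: "z \<in> S \<Longrightarrow> disc_chain S z z 0"
| step: "disc_chain S z (\<phi> a) l \<Longrightarrow> \<phi> \<in> analytic_discs S \<Longrightarrow> cmod a < 1 \<Longrightarrow> cmod b < 1 \<Longrightarrow>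
    disc_chain S z (\<phi> b) (l + poincare_dist a b)"

lemma disc_chain_in: "disc_chain S z w l \<Longrightarrow> z \<in> S \<and> w \<in> S \<and> 0 \<le> l"
  by (induction rule: disc_chain.induct) (auto dest: analytic_discsD(2) simp: poincare_dist_nonneg)

lemma disc_chain_single:
  assumes "\<phi> \<in> analytic_discs S" "cmod a < 1" "cmod b < 1"
  shows "disc_chain S (\<phi> a) (\<phi> b) (poincare_dist a b)"
  using disc_chain.step[OF disc_chain.nil assms] analytic_discsD(2)[OF assms(1,2)] by simp

lemma disc_chain_trans:
  assumes "disc_chain S z w l" "disc_chain S w x l'"
  shows "disc_chain S z x (l + l')"
  using assms(2)
proof (induction rule: disc_chain.induct)
  case nil then show ?case using assms(1) by simp
next
  case (step \<phi> a l b)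
  then show ?case using disc_chain.step[of S z \<phi> a _ b] by (metis add.assoc)
qed

lemma disc_chain_sum:
  assumes "z \<in> S" "p 0 = z"
    "\<forall>j<m. \<phi> j \<in> analytic_discs S \<and> a j \<in> ball 0 1 \<and> b j \<in> ball 0 1 \<and>
       \<phi> j (a j) = p j \<and> \<phi> j (b j) = p (Suc j)"
  shows "disc_chain S z (p m) (\<Sum>j<m. poincare_dist (a j) (b j))"
  using assms(3)
proof (induction m)
  case 0 then show ?case using assms disc_chain.nil by simp
next
  case (Suc m)
  then have "disc_chain S z (\<phi> m (a m)) (\<Sum>j<m. poincare_dist (a j) (b j))"
    by (metis less_Suc_eq)
  from disc_chain.step[where \<phi> = "\<phi> m", OF this, of "b m"] Suc.prems show ?case by auto
qed

lemma disc_chain_imp_sum: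
  assumes "disc_chain S z w l"
  shows "\<exists>m a b. l = (\<Sum>j<m. poincare_dist (a j) (b j)) \<and> m \<ge> 1 \<and>
    (\<exists>\<phi> p. p 0 = z \<and> p m = w \<and>
      (\<forall>j<m. \<phi> j \<in> analytic_discs S \<and> a j \<in> ball 0 1 \<and> b j \<in> ball 0 1 \<and>
             \<phi> j (a j) = p j \<and> \<phi> j (b j) = p (Suc j)))"
  using assms
proof (induction rule: disc_chain.induct)
  \<comment> \<open>\<open>kobayashi_dist\<close> asks for at least one link, so the empty chain
    becomes a single constant disc of length 0.\<close>
  case nil
  then show ?case
    by (intro exI[of _ "Suc 0"] exI[of _ "\<lambda>_. 0"] conjI exI[of _ "\<lambda>_ _. z"] exI[of _ "\<lambda>_. z"])
      (auto simp: poincare_dist_0 analytic_discs_const)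
next
  case (step \<phi> a l b)
  then obtain m a' b' \<phi>' p where *: "l = (\<Sum>j<m. poincare_dist (a' j) (b' j))" "m \<ge> 1"
    "p 0 = z" "p m = \<phi> a"
    "\<forall>j<m. \<phi>' j \<in> analytic_discs S \<and> a' j \<in> ball 0 1 \<and> b' j \<in> ball 0 1 \<and>
             \<phi>' j (a' j) = p j \<and> \<phi>' j (b' j) = p (Suc j)" by blast
  show ?case
    by (intro exI[of _ "Suc m"] exI[of _ "a'(m := a)"] exI[of _ "b'(m := b)"] conjI
        exI[of _ "\<phi>'(m := \<phi>)"] exI[of _ "p(Suc m := \<phi> b)"])
      (use * step in \<open>auto simp: less_Suc_eq\<close>)
qed

section \<open>The Kobayashi distance as an infimum over chains\<close>

lemma kobayashi_dist_eq_Inf_chain: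
  assumes "z \<in> S" "w \<in> S"
  shows "kobayashi_dist S z w = Inf {l. disc_chain S z w l}"
proof -
  have "{(\<Sum>j<m. poincare_dist (a j) (b j)) | m a b.
              m \<ge> 1 \<and>
              (\<exists>\<phi> p. p 0 = z \<and> p m = w \<and>
                (\<forall>j<m. \<phi> j \<in> analytic_discs S \<and> a j \<in> ball 0 1 \<and> b j \<in> ball 0 1 \<and>
                       \<phi> j (a j) = p j \<and> \<phi> j (b j) = p (Suc j)))} = {l. disc_chain S z w l}"
    (is "?L = ?R")
  proof
    show "?L \<subseteq> ?R"
    proof (intro subsetI, elim CollectE exE conjE)
      fix l m a b \<phi> p
      assume "l = (\<Sum>j<m. poincare_dist (a j) (b j))" "p 0 = z" "p m = w"
        "\<forall>j<m. \<phi> j \<in> analytic_discs S \<and> a j \<in> ball 0 1 \<and> b j \<in> ball 0 1 \<and>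
                       \<phi> j (a j) = p j \<and> \<phi> j (b j) = p (Suc j)"
      then show "l \<in> ?R" using disc_chain_sum[OF assms(1), of p m \<phi> a b] by simp
    qed
    show "?R \<subseteq> ?L" using disc_chain_imp_sum[of S z w] by (intro subsetI) (simp only: mem_Collect_eq)
  qed
  then show ?thesis using assms unfolding kobayashi_dist_def by simp
qed

lemma kobayashi_dist_le_chain:
  assumes "disc_chain S z w l"
  shows "kobayashi_dist S z w \<le> l"
proof -
  have "bdd_below {l. disc_chain S z w l}" by (rule bdd_belowI[of _ 0]) (auto dest: disc_chain_in)
  then show ?thesis
    using disc_chain_in[OF assms] assms by (auto simp: kobayashi_dist_eq_Inf_chain intro!: cInf_lower)
qed

lemma kobayashi_dist_le_poincare:
  assumes "\<phi> \<in> analytic_discs S" "cmod a < 1" "cmod b < 1"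
  shows "kobayashi_dist S (\<phi> a) (\<phi> b) \<le> poincare_dist a b"
  by (rule kobayashi_dist_le_chain[OF disc_chain_single[OF assms]])

text \<open>Uses the affine disc centred at \<open>z\<close> that has \<open>w\<close> on a radius
  of Euclidean length \<open>r\<close>. Both directions are recorded because symmetry of the
  distance is not at hand here.\<close>

lemma disc_chain_ball:
  assumes "ball z r \<subseteq> S" "dist z w < r"
  shows "disc_chain S z w (artanh (dist z w / r))" "disc_chain S w z (artanh (dist z w / r))"
proof -
  have r: "0 < r" using assms(2) by (metis zero_le_dist order_le_less_trans)
  define v where "v = (if w = z then 0 else of_real (r / dist z w) *s (w - z))"
  have "norm v \<le> r"
  proof (cases "w = z")
    case False
    have "norm v = cmod (of_real (r / dist z w)) * norm (w - z)"
      using False by (simp only: v_def norm_scalar_mult_vec if_False)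
    then show ?thesis using False r by (simp add: dist_norm norm_minus_commute norm_divide)
  qed (use r in \<open>simp add: v_def\<close>)
  then have nv: "norm (\<zeta> *s v) \<le> cmod \<zeta> * r" for \<zeta>
    by (simp add: norm_scalar_mult_vec mult_left_mono)
  have d: "(\<lambda>\<zeta>. z + \<zeta> *s v) \<in> analytic_discs S"
  proof (rule analytic_discs_linear)
    fix \<zeta> :: complex assume "cmod \<zeta> < 1"
    then have "cmod \<zeta> * r < 1 * r" using r by (intro mult_strict_right_mono) auto
    then have "norm (\<zeta> *s v) < r" using nv[of \<zeta>] by linarith
    then show "z + \<zeta> *s v \<in> S" using assms(1) by (auto simp: dist_norm)
  qed
  define t where "t = dist z w / r"
  have t: "0 \<le> t" "t < 1" using assms(2) r by (auto simp: t_def)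
  have e: "z + of_real t *s v = w"
    using r by (cases "w = z") (auto simp: v_def t_def vector_smult_assoc field_simps)
  from disc_chain_single[OF d, of 0 "of_real t"] disc_chain_single[OF d, of "of_real t" 0] e t
  show "disc_chain S z w (artanh (dist z w / r))" "disc_chain S w z (artanh (dist z w / r))"
    by (auto simp: poincare_dist_0 t_def[symmetric])
qed

text \<open>Mutual reachability is symmetric and transitive, and holds locally by the ball estimate;
  connectedness makes it global.\<close>

lemma disc_chain_exists:
  assumes "cn_domain S" "z \<in> S" "w \<in> S"
  shows "\<exists>l. disc_chain S z w l"
proof -
  have S: "open S" "connected S" using assms by (auto simp: cn_domain_def)
  define R where "R = (\<lambda>x y. (\<exists>l. disc_chain S x y l) \<and> (\<exists>l. disc_chain S y x l))"
  have "R z w"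
  proof (rule connected_equivalence_relation[OF S(2) assms(2,3), where R = R])
    fix x assume "x \<in> S"
    then obtain r where r: "r > 0" "ball x r \<subseteq> S" using S(1) open_contains_ball by blast
    show "\<exists>T. openin (top_of_set S) T \<and> x \<in> T \<and> (\<forall>y\<in>T. R x y)"
    proof (intro exI[of _ "ball x r"] conjI ballI)
      show "openin (top_of_set S) (ball x r)" using r S(1) by (simp add: openin_open_eq)
      show "R x y" if "y \<in> ball x r" for y
        using disc_chain_ball[OF r(2), of y] that unfolding R_def by auto
    qed (use r in auto)
  qed (auto simp: R_def intro: disc_chain_trans)
  then show ?thesis by (simp add: R_def)
qed

lemma disc_chain_near_inf:
  assumes "cn_domain S" "z \<in> S" "w \<in> S" "kobayashi_dist S z w < c"
  obtains l where "disc_chain S z w l" "l < c"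
proof -
  have "bdd_below {l. disc_chain S z w l}" by (rule bdd_belowI[of _ 0]) (auto dest: disc_chain_in)
  then show ?thesis using that assms disc_chain_exists[OF assms(1-3)]
    by (auto simp: kobayashi_dist_eq_Inf_chain cInf_less_iff)
qed

lemma kobayashi_dist_triangle:
  assumes "cn_domain S" "x \<in> S" "y \<in> S" "z \<in> S"
  shows "kobayashi_dist S x z \<le> kobayashi_dist S x y + kobayashi_dist S y z"
proof (rule field_le_epsilon)
  fix e :: real assume e: "e > 0"
  obtain l where l: "disc_chain S x y l" "l < kobayashi_dist S x y + e/2"
    using disc_chain_near_inf[OF assms(1,2,3), of "kobayashi_dist S x y + e/2"] e by auto
  obtain l' where l': "disc_chain S y z l'" "l' < kobayashi_dist S y z + e/2"
    using disc_chain_near_inf[OF assms(1,3,4), of "kobayashi_dist S y z + e/2"] e by auto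
  show "kobayashi_dist S x z \<le> kobayashi_dist S x y + kobayashi_dist S y z + e"
    using kobayashi_dist_le_chain[OF disc_chain_trans[OF l(1) l'(1)]] l l' by linarith
qed

text \<open>Triangle inequalities in both variables bound the variation by distances between nearby
  points, and these tend to 0 by the \<open>artanh\<close> estimate in small balls.\<close>

lemma kobayashi_dist_continuous_on:
  assumes "cn_domain S"
  shows "continuous_on (S \<times> S) (\<lambda>(x, y). kobayashi_dist S x y)"
  unfolding continuous_on_def
proof (rule ballI, clarify)
  fix x y assume xy: "x \<in> S" "y \<in> S"
  have o: "open S" using assms by (simp add: cn_domain_def)
  let ?k = "kobayashi_dist S"
  have near: "eventually (\<lambda>q. q \<in> S \<and> ?k p q \<le> artanh (dist p q / r) \<and> ?k q p \<le> artanh (dist p q / r)) (nhds p)"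
    if "r > 0" "ball p r \<subseteq> S" for p r
    using that disc_chain_ball[OF that(2)]
    by (intro eventually_nhds_in_open[of "ball p r", THEN eventually_mono])
      (auto intro: kobayashi_dist_le_chain)
  obtain r s where r: "r > 0" "ball x r \<subseteq> S" and s: "s > 0" "ball y s \<subseteq> S"
    using o xy open_contains_ball by metis
  let ?F = "at (x, y) within S \<times> S"
  have lim: "filterlim fst (nhds x) ?F" "filterlim snd (nhds y) ?F"
    using tendsto_fst[OF tendsto_ident_at] tendsto_snd[OF tendsto_ident_at] by force+
  have ev: "\<forall>\<^sub>F q in ?F. \<bar>?k (fst q) (snd q) - ?k x y\<bar> \<le> artanh (dist x (fst q) / r) + artanh (dist y (snd q) / s)"
    using eventually_compose_filterlim[OF near[OF r] lim(1)] eventually_compose_filterlim[OF near[OF s] lim(2)]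
  proof eventually_elim
    case (elim q)
    then show ?case
      using kobayashi_dist_triangle[OF assms, of x y "snd q"] kobayashi_dist_triangle[OF assms, of x "snd q" y]
        kobayashi_dist_triangle[OF assms, of "fst q" x "snd q"] kobayashi_dist_triangle[OF assms, of x "fst q" "snd q"] xy
      by auto
  qed
  have z: "((\<lambda>q. artanh (dist x (fst q) / r) + artanh (dist y (snd q) / s)) \<longlongrightarrow>
      artanh (dist x x / r) + artanh (dist y y / s)) ?F"
    using lim r s by (intro tendsto_intros) auto
  have "((\<lambda>q. ?k (fst q) (snd q) - ?k x y) \<longlongrightarrow> 0) ?F"
    by (rule Lim_null_comparison[where g = "\<lambda>q. artanh (dist x (fst q) / r) + artanh (dist y (snd q) / s)"])
      (use ev z in auto)
  then show "((\<lambda>(x, y). ?k x y) \<longlongrightarrow> ?k x y) ?F" by (simp add: split_def LIM_zero_iff)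
qed

section \<open>Curves made of radii of discs\<close>

text \<open>
  Discs are parametrised along radii by \<open>tanh h\<close>, so that the Poincare distance between the points
  of parameters \<open>0\<close> and \<open>h\<close> is \<open>h\<close>.
\<close>

definition disc_germ :: "(complex ^ 'n) set \<Rightarrow> real set \<Rightarrow> (real \<Rightarrow> complex ^ 'n) \<Rightarrow> bool" where
  "disc_germ S I f \<longleftrightarrow>
    (\<exists>\<phi>\<in>analytic_discs S. \<exists>\<delta>>0. \<forall>h\<in>I. \<bar>h\<bar> < \<delta> \<longrightarrow> f h = \<phi> (of_real (tanh h)))"

text \<open>Curves live on the whole line, which avoids special end points. One-sided germs, present
  at every time, carry the length estimates across the break points of a chain; two-sided germs, off
  a finite set, give derivatives almost everywhere.\<close>

definition disc_curve :: "(complex ^ 'n) set \<Rightarrow> (real \<Rightarrow> complex ^ 'n) \<Rightarrow> bool" where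
  "disc_curve S \<sigma> \<longleftrightarrow>
    (\<forall>t. disc_germ S {0..} (\<lambda>h. \<sigma> (t + h)) \<and> disc_germ S {0..} (\<lambda>h. \<sigma> (t - h))) \<and>
    (\<exists>F. finite F \<and> (\<forall>t. t \<notin> F \<longrightarrow> disc_germ S UNIV (\<lambda>h. \<sigma> (t + h))))"

section \<open>Shifting, reversing and gluing disc curves\<close>

lemma disc_germ_subset: "disc_germ S I f \<Longrightarrow> J \<subseteq> I \<Longrightarrow> disc_germ S J f"
  unfolding disc_germ_def by blast

lemma disc_germ_cong:
  assumes "disc_germ S I f" "d > 0" "\<And>h. h \<in> I \<Longrightarrow> \<bar>h\<bar> < d \<Longrightarrow> g h = f h"
  shows "disc_germ S I g"
proof -
  obtain \<phi> \<delta> where "\<phi> \<in> analytic_discs S" "\<delta> > 0" "\<forall>h\<in>I. \<bar>h\<bar> < \<delta> \<longrightarrow> f h = \<phi> (of_real (tanh h))"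
    using assms(1) unfolding disc_germ_def by blast
  then show ?thesis unfolding disc_germ_def using assms(2,3)
    by (intro bexI[of _ \<phi>] exI[of _ "min d \<delta>"]) auto
qed

lemma disc_germ_uminus:
  assumes "disc_germ S I f"
  shows "disc_germ S (uminus ` I) (\<lambda>h. f (- h))"
proof -
  obtain \<phi> \<delta> where p: "\<phi> \<in> analytic_discs S" "\<delta> > 0" "\<forall>h\<in>I. \<bar>h\<bar> < \<delta> \<longrightarrow> f h = \<phi> (of_real (tanh h))"
    using assms unfolding disc_germ_def by blast
  have "(\<lambda>\<zeta>. \<phi> (- \<zeta>)) \<in> analytic_discs S"
    using analytic_discsD(2)[OF p(1)] by (intro analytic_discs_compose[OF p(1)] holomorphic_intros) auto
  then show ?thesis unfolding disc_germ_def using p(2,3)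
    by (intro bexI[of _ "\<lambda>\<zeta>. \<phi> (- \<zeta>)"] exI[of _ \<delta>]) auto
qed

lemma disc_curve_in:
  assumes "disc_curve S \<sigma>"
  shows "\<sigma> t \<in> S"
proof -
  have "disc_germ S {0..} (\<lambda>h. \<sigma> (t + h))" using assms by (simp add: disc_curve_def)
  then obtain \<phi> \<delta> where "\<phi> \<in> analytic_discs S" "\<delta> > 0"
    "\<forall>h\<in>{0..}. \<bar>h\<bar> < \<delta> \<longrightarrow> \<sigma> (t + h) = \<phi> (of_real (tanh h))"
    unfolding disc_germ_def by blast
  then show ?thesis using analytic_discsD(2)[of \<phi> S 0] by fastforce
qed

lemma disc_curve_shift:
  assumes "disc_curve S \<sigma>"
  shows "disc_curve S (\<lambda>t. \<sigma> (a + t))"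
proof -
  obtain F where F: "finite F" "\<And>t. t \<notin> F \<Longrightarrow> disc_germ S UNIV (\<lambda>h. \<sigma> (t + h))"
    using assms unfolding disc_curve_def by blast
  have 1: "disc_germ S {0..} (\<lambda>h. \<sigma> (a + (t + h)))" "disc_germ S {0..} (\<lambda>h. \<sigma> (a + (t - h)))" for t
    using assms unfolding disc_curve_def by (simp_all flip: add.assoc add_diff_eq) (simp add: add_diff_eq)
  have "t \<notin> (\<lambda>x. x - a) ` F \<Longrightarrow> disc_germ S UNIV (\<lambda>h. \<sigma> (a + (t + h)))" for t
    using F(2)[of "a + t"] by (force simp: add.assoc)
  with 1 F(1) show ?thesis unfolding disc_curve_def
    by (intro conjI exI[of _ "(\<lambda>x. x - a) ` F"]) auto
qed

lemma disc_curve_reverse: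
  assumes "disc_curve S \<sigma>"
  shows "disc_curve S (\<lambda>t. \<sigma> (a - t))"
proof -
  obtain F where F: "finite F" "\<And>t. t \<notin> F \<Longrightarrow> disc_germ S UNIV (\<lambda>h. \<sigma> (t + h))"
    using assms unfolding disc_curve_def by blast
  have 1: "disc_germ S {0..} (\<lambda>h. \<sigma> (a - (t + h)))" "disc_germ S {0..} (\<lambda>h. \<sigma> (a - (t - h)))" for t
    using assms unfolding disc_curve_def
    by (simp_all add: diff_diff_eq[symmetric] diff_diff_eq2 diff_add_eq[symmetric])
  have "disc_germ S UNIV (\<lambda>h. \<sigma> (a - (t + h)))" if "t \<notin> (\<lambda>x. a - x) ` F" for t
  proof -
    have "a - t \<notin> F" using that by force
    from disc_germ_uminus[OF F(2)[OF this]] show ?thesis by (simp add: algebra_simps)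
  qed
  with 1 F(1) show ?thesis unfolding disc_curve_def
    by (intro conjI exI[of _ "(\<lambda>x. a - x) ` F"]) auto
qed

lemma disc_curve_const: "z \<in> S \<Longrightarrow> disc_curve S (\<lambda>_. z)"
  unfolding disc_curve_def disc_germ_def
  by (intro conjI allI exI[of _ "{}"] bexI[of _ "\<lambda>_. z"] exI[of _ 1] impI analytic_discs_const) auto

text \<open>By the addition formula for \<open>tanh\<close>, moving the base time to
  \<open>t\<close> amounts to an automorphism of the unit disc, so the reparametrised disc serves as
  germ at \<open>t\<close>.\<close>

lemma disc_curve_tanh:
  assumes "\<phi> \<in> analytic_discs S"
  shows "disc_curve S (\<lambda>t. \<phi> (of_real (tanh t)))"
proof -
  have *: "disc_germ S UNIV (\<lambda>h. \<phi> (of_real (tanh (t + h))))" for t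
  proof -
    define m where "m = Moebius_function 0 (- of_real (tanh t))"
    have c: "cmod (- complex_of_real (tanh t)) < 1"
      using tanh_real_lt_1[of t] tanh_real_gt_neg1[of t] by (simp add: abs_less_iff)
    have m: "m holomorphic_on ball 0 1" "m ` ball 0 1 \<subseteq> ball 0 1"
      unfolding m_def using c by (auto intro!: Moebius_function_holomorphic Moebius_function_norm_lt_1)
    have d: "(\<lambda>\<zeta>. \<phi> (m \<zeta>)) \<in> analytic_discs S"
      using m by (intro analytic_discs_compose[OF assms m] analytic_discsD(2)[OF assms])
        (auto simp: image_subset_iff)
    have "m (of_real (tanh h)) = of_real (tanh (t + h))" for h
      by (simp add: m_def Moebius_function_simple tanh_add add.commute)
    then show ?thesis unfolding disc_germ_def
      by (intro bexI[OF _ d] exI[of _ 1]) auto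
  qed
  have "disc_germ S {0..} (\<lambda>h. \<phi> (of_real (tanh (t - h))))" for t
    using disc_germ_uminus[OF *[of t]] by (auto intro: disc_germ_subset)
  with * show ?thesis unfolding disc_curve_def
    by (intro conjI allI exI[of _ "{}"]) (auto intro: disc_germ_subset[where I = UNIV])
qed

lemma disc_curve_join:
  assumes "disc_curve S \<sigma>" "disc_curve S \<tau>" "\<sigma> c = \<tau> c"
  shows "disc_curve S (\<lambda>t. if t \<le> c then \<sigma> t else \<tau> t)"
proof -
  let ?g = "\<lambda>t. if t \<le> c then \<sigma> t else \<tau> t"
  obtain F where F: "finite F" "\<And>t. t \<notin> F \<Longrightarrow> disc_germ S UNIV (\<lambda>h. \<sigma> (t + h))"
    using assms(1) unfolding disc_curve_def by blast
  obtain F' where F': "finite F'" "\<And>t. t \<notin> F' \<Longrightarrow> disc_germ S UNIV (\<lambda>h. \<tau> (t + h))"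
    using assms(2) unfolding disc_curve_def by blast
  have g: "disc_germ S {0..} (\<lambda>h. \<sigma> (t + h))" "disc_germ S {0..} (\<lambda>h. \<sigma> (t - h))"
    "disc_germ S {0..} (\<lambda>h. \<tau> (t + h))" "disc_germ S {0..} (\<lambda>h. \<tau> (t - h))" for t
    using assms unfolding disc_curve_def by auto
  have r: "disc_germ S {0..} (\<lambda>h. ?g (t + h))" for t
  proof (cases "t < c")
    case True
    then show ?thesis by (intro disc_germ_cong[OF g(1)[of t], of "c - t"]) auto
  next
    case False
    have "?g (t + h) = \<tau> (t + h)" if "0 \<le> h" for h
      using that False assms(3) by (cases "t + h = c") auto
    then show ?thesis by (intro disc_germ_cong[OF g(3)[of t], of 1]) auto
  qed
  have l: "disc_germ S {0..} (\<lambda>h. ?g (t - h))" for t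
  proof (cases "t \<le> c")
    case True
    then show ?thesis by (intro disc_germ_cong[OF g(2)[of t], of 1]) auto
  next
    case False
    then show ?thesis by (intro disc_germ_cong[OF g(4)[of t], of "t - c"]) auto
  qed
  have "disc_germ S UNIV (\<lambda>h. ?g (t + h))" if "t \<notin> insert c (F \<union> F')" for t
  proof (cases "t < c")
    case True
    then show ?thesis using that by (intro disc_germ_cong[OF F(2)[of t], of "c - t"]) auto
  next
    case False
    then show ?thesis using that by (intro disc_germ_cong[OF F'(2)[of t], of "t - c"]) auto
  qed
  with r l F(1) F'(1) show ?thesis unfolding disc_curve_def
    by (intro conjI allI exI[of _ "insert c (F \<union> F')"]) auto
qed

text \<open>Each link, normalised to a radius, is run through in a time equal to its Poincare
  length, and the links are glued one after another.\<close>

lemma disc_curve_of_chain: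
  assumes "disc_chain S z w l"
  shows "\<exists>\<sigma>. disc_curve S \<sigma> \<and> \<sigma> 0 = z \<and> \<sigma> l = w"
  using assms
proof (induction rule: disc_chain.induct)
  case nil
  then show ?case using disc_curve_const by (intro exI[of _ "\<lambda>_. z"]) auto
next
  case (step \<phi> a l b)
  then obtain \<sigma> where \<sigma>: "disc_curve S \<sigma>" "\<sigma> 0 = z" "\<sigma> l = \<phi> a" by blast
  obtain \<psi> where \<psi>: "\<psi> \<in> analytic_discs S" "\<psi> 0 = \<phi> a"
    "\<psi> (of_real (tanh (poincare_dist a b))) = \<phi> b"
    using normalized_disc[OF step(2-4)] by blast
  define \<tau> where "\<tau> = (\<lambda>t. \<psi> (of_real (tanh (- l + t))))"
  have \<tau>: "disc_curve S \<tau>" unfolding \<tau>_def by (rule disc_curve_shift[OF disc_curve_tanh[OF \<psi>(1)]])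
  have "0 \<le> l" "0 \<le> poincare_dist a b"
    using disc_chain_in[OF step(1)] poincare_dist_nonneg[OF step(3,4)] by auto
  moreover have "\<sigma> l = \<tau> l" by (simp add: \<tau>_def \<psi> \<sigma>)
  ultimately show ?case using disc_curve_join[OF \<sigma>(1) \<tau>, of l] \<sigma> \<psi>
    by (intro exI[of _ "\<lambda>t. if t \<le> l then \<sigma> t else \<tau> t"]) (auto simp: \<tau>_def)
qed

text \<open>Shrinking a disc by the factor \<open>\<rho>\<close> puts it into \<open>U\<close>, so
  the distance in \<open>U\<close> is at most \<open>artanh (tanh h / \<rho>)\<close>. This has
  slope \<open>1 / \<rho>\<close> at 0, strictly below the slope \<open>g\<close> of
  \<open>H\<close>, whence the bound for small \<open>h\<close>.\<close>

lemma disc_germ_kobayashi_dist_less: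
  assumes U: "U \<subseteq> S" and f: "disc_germ S {0..} f" and \<rho>: "0 < \<rho>" "\<rho> \<le> 1"
    and sub: "\<And>\<phi> \<zeta>. \<phi> \<in> analytic_discs S \<Longrightarrow> \<phi> 0 = f 0 \<Longrightarrow> cmod \<zeta> < \<rho> \<Longrightarrow> \<phi> \<zeta> \<in> U"
    and H: "(H has_real_derivative g) (at 0)" "H 0 = 0" "1 / \<rho> < g"
  shows "\<exists>d>0. \<forall>h. 0 \<le> h \<and> h < d \<longrightarrow>
    kobayashi_dist U (f 0) (f h) \<le> H h \<and> kobayashi_dist U (f h) (f 0) \<le> H h"
proof -
  obtain \<phi> \<delta> where p: "\<phi> \<in> analytic_discs S" "\<delta> > 0" "\<And>h. 0 \<le> h \<Longrightarrow> h < \<delta> \<Longrightarrow> f h = \<phi> (of_real (tanh h))"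
    using f unfolding disc_germ_def by fastforce
  have p0: "\<phi> 0 = f 0" using p(3)[of 0] p(2) by simp
  define \<psi> where "\<psi> = (\<lambda>\<zeta>. \<phi> (of_real \<rho> * \<zeta>))"
  have small: "cmod (of_real \<rho> * \<zeta>) < \<rho>" if "cmod \<zeta> < 1" for \<zeta>
    using that \<rho> by (simp add: norm_mult)
  have \<psi>: "\<psi> \<in> analytic_discs U" unfolding \<psi>_def
  proof (rule analytic_discs_compose[OF p(1)])
    show "(*) (complex_of_real \<rho>) ` ball 0 1 \<subseteq> ball 0 1" using small \<rho> by force
  qed (use small sub[OF p(1) p0] in \<open>auto intro!: holomorphic_intros\<close>)
  define A where "A = (\<lambda>h. artanh (tanh h / \<rho>))"
  have "((\<lambda>h. tanh h / \<rho>) has_real_derivative 1 / \<rho>) (at 0)" using \<rho>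
    by (auto intro!: derivative_eq_intros)
  moreover have "(artanh has_real_derivative 1) (at (tanh 0 / \<rho>))"
    using artanh_real_has_field_derivative[of 0 UNIV] by simp
  ultimately have "(A has_real_derivative 1 / \<rho>) (at 0)"
    unfolding A_def using DERIV_chain2 by fastforce
  from DERIV_diff[OF H(1) this] have "((\<lambda>h. H h - A h) has_real_derivative g - 1 / \<rho>) (at 0)" .
  from DERIV_pos_inc_right[OF this] H(3) obtain d where d: "d > 0"
    "\<And>h. 0 < h \<Longrightarrow> h < d \<Longrightarrow> H 0 - A 0 < H h - A h" by auto
  have AH: "A h \<le> H h" if "0 \<le> h" "h < d" for h
    using d(2)[of h] that H(2) by (cases "h = 0") (auto simp: A_def)
  \<comment> \<open>\<open>d\<close> serves the comparison of slopes and \<open>\<delta>\<close> the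
    germ; the third bound keeps \<open>tanh h / \<rho>\<close> below 1/2, hence inside the unit
    disc.\<close>
  define d' where "d' = Min {d, \<delta>, artanh (\<rho> / 2)}"
  have "artanh (\<rho> / 2) > 0"
    using \<rho> tanh_artanh_real[of "\<rho>/2"] by (metis abs_of_pos half_gt_zero_iff tanh_real_pos_iff
        field_sum_of_halves less_add_same_cancel1 order_less_le_trans)
  then have d': "d' > 0" using d p(2) by (auto simp: d'_def)
  have "kobayashi_dist U (f 0) (f h) \<le> H h \<and> kobayashi_dist U (f h) (f 0) \<le> H h" if h: "0 \<le> h" "h < d'" for h
  proof -
    have "tanh h < tanh (artanh (\<rho> / 2))" using h by (simp add: d'_def)
    also have "\<dots> = \<rho> / 2" using \<rho> by (intro tanh_artanh_real) auto
    finally have t: "tanh h / \<rho> < 1" "0 \<le> tanh h / \<rho>" using \<rho> h by auto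
    have fh: "f h = \<psi> (of_real (tanh h / \<rho>))" "f 0 = \<psi> 0"
      using p(3)[of h] h \<rho> p0 by (auto simp: d'_def \<psi>_def)
    have n: "cmod (of_real (tanh h / \<rho>)) = tanh h / \<rho>" using t by (simp only: norm_of_real abs_of_nonneg)
    show ?thesis
      using kobayashi_dist_le_poincare[OF \<psi>, of 0 "of_real (tanh h / \<rho>)"]
        kobayashi_dist_le_poincare[OF \<psi>, of "of_real (tanh h / \<rho>)" 0] t AH[of h] h
      unfolding fh poincare_dist_0 n A_def[symmetric] by (auto simp: d'_def A_def)
  qed
  with d' show ?thesis by blast
qed

text \<open>
  If every disc of \<open>S\<close> centred at \<open>\<sigma> x\<close> maps the disc of radius \<open>\<rho> x\<close> into \<open>U\<close>, then the Kobayashi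
  metric of \<open>U\<close> along \<open>\<sigma>\<close> is at most \<open>1 / \<rho> x\<close>; this is the integrated form of that estimate.
\<close>

lemma kobayashi_dist_along_disc_curve:
  assumes U: "cn_domain U" "U \<subseteq> S" and \<sigma>: "disc_curve S \<sigma>" and ab: "a \<le> b"
    and \<rho>: "\<And>x. a \<le> x \<Longrightarrow> x \<le> b \<Longrightarrow> 0 < \<rho> x \<and> \<rho> x \<le> 1"
    and sub: "\<And>x \<phi> \<zeta>. a \<le> x \<Longrightarrow> x \<le> b \<Longrightarrow> \<phi> \<in> analytic_discs S \<Longrightarrow> \<phi> 0 = \<sigma> x \<Longrightarrow> cmod \<zeta> < \<rho> x
      \<Longrightarrow> \<phi> \<zeta> \<in> U"
    and G: "\<And>x. a \<le> x \<Longrightarrow> x \<le> b \<Longrightarrow> (G has_real_derivative g x) (at x)"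
      "\<And>x. a \<le> x \<Longrightarrow> x \<le> b \<Longrightarrow> 1 / \<rho> x < g x"
  shows "kobayashi_dist U (\<sigma> a) (\<sigma> b) \<le> G b - G a"
proof -
  have inU: "\<sigma> x \<in> U" if x: "a \<le> x" "x \<le> b" for x
  proof -
    have "disc_germ S {0..} (\<lambda>h. \<sigma> (x + h))" using \<sigma> by (simp add: disc_curve_def)
    then obtain \<phi> \<delta> where "\<phi> \<in> analytic_discs S" "\<delta> > 0" "\<forall>h\<in>{0..}. \<bar>h\<bar> < \<delta> \<longrightarrow> \<sigma> (x + h) = \<phi> (of_real (tanh h))"
      unfolding disc_germ_def by blast
    then show ?thesis using sub[OF x, of \<phi> 0] \<rho>[OF x] by fastforce
  qed
  \<comment> \<open>The premise makes \<open>P\<close> vacuous on intervals sticking out of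
    \<open>{a..b}\<close>, which the local condition of the bisection principle also covers.\<close>
  define P where "P = (\<lambda>u v. a \<le> u \<and> v \<le> b \<longrightarrow> kobayashi_dist U (\<sigma> u) (\<sigma> v) \<le> G v - G u)"
  have "P a b" using ab
  proof (induction rule: Bolzano)
    case (trans u v w)
    then show ?case
      using kobayashi_dist_triangle[OF U(1), of "\<sigma> u" "\<sigma> v" "\<sigma> w"] inU unfolding P_def by fastforce
  next
    case (local x)
    have r: "disc_germ S {0..} (\<lambda>h. \<sigma> (x + h))" "disc_germ S {0..} (\<lambda>h. \<sigma> (x - h))"
      using \<sigma> by (simp_all add: disc_curve_def)
    have Gx: "(G has_real_derivative g x) (at (x + 0))" "(G has_real_derivative g x) (at (x - 0))"
      using G(1) local by auto
    have "((\<lambda>h. G (x + h) - G x) has_real_derivative g x) (at 0)"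
      using Gx(1) by (auto intro!: derivative_eq_intros DERIV_chain2[where g = "\<lambda>h. x + h"])
    from disc_germ_kobayashi_dist_less[where \<rho> = "\<rho> x", OF U(2) r(1) _ _ _ this] \<rho>[of x] sub[of x] G(2)[of x] local
    obtain d1 where d1: "d1 > 0" "\<And>h. 0 \<le> h \<Longrightarrow> h < d1 \<Longrightarrow> kobayashi_dist U (\<sigma> x) (\<sigma> (x + h)) \<le> G (x + h) - G x"
      by auto
    \<comment> \<open>Time runs backwards here, so the second inequality of the germ lemma gives the
      distance from the earlier point to the later one.\<close>
    have "((\<lambda>h. G x - G (x - h)) has_real_derivative g x) (at 0)"
      using Gx(2) by (auto intro!: derivative_eq_intros DERIV_chain2[where g = "\<lambda>h. x - h"])
    from disc_germ_kobayashi_dist_less[where \<rho> = "\<rho> x", OF U(2) r(2) _ _ _ this] \<rho>[of x] sub[of x] G(2)[of x] local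
    obtain d2 where d2: "d2 > 0" "\<And>h. 0 \<le> h \<Longrightarrow> h < d2 \<Longrightarrow> kobayashi_dist U (\<sigma> (x - h)) (\<sigma> x) \<le> G x - G (x - h)"
      by auto
    show ?case
    proof (intro exI[of _ "min d1 d2"] conjI allI impI)
      fix u v assume uv: "u \<le> x \<and> x \<le> v \<and> v - u < min d1 d2"
      then have "kobayashi_dist U (\<sigma> u) (\<sigma> x) \<le> G x - G u" "kobayashi_dist U (\<sigma> x) (\<sigma> v) \<le> G v - G x"
        using d1(2)[of "v - x"] d2(2)[of "x - u"] by auto
      then show "P u v"
        using kobayashi_dist_triangle[OF U(1), of "\<sigma> u" "\<sigma> x" "\<sigma> v"] inU uv unfolding P_def by fastforce
    qed (use d1 d2 in auto)
  qed
  then show ?thesis by (simp add: P_def)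
qed

text \<open>The integrated estimate with \<open>U = S\<close> and radius 1. It demands a slope
  strictly above 1, so \<open>inverse c\<close> is taken and \<open>c\<close> tends to 1; time
  reversal deals with \<open>s > t\<close>.\<close>

lemma kobayashi_dist_disc_curve_le:
  assumes "cn_domain S" "disc_curve S \<sigma>"
  shows "kobayashi_dist S (\<sigma> s) (\<sigma> t) \<le> \<bar>s - t\<bar>"
proof -
  have *: "kobayashi_dist S (\<tau> a) (\<tau> b) \<le> b - a" if "disc_curve S \<tau>" "a \<le> b" for \<tau> a b
  proof (rule field_le_mult_one_interval)
    fix c :: real assume c: "0 < c" "c < 1"
    have "kobayashi_dist S (\<tau> a) (\<tau> b) \<le> inverse c * b - inverse c * a"
      by (rule kobayashi_dist_along_disc_curve[where S = S and \<rho> = "\<lambda>_. 1" and g = "\<lambda>_. inverse c"])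
        (use assms that c in \<open>auto intro!: derivative_eq_intros simp: analytic_discsD(2) one_less_inverse_iff\<close>)
    then show "c * kobayashi_dist S (\<tau> a) (\<tau> b) \<le> b - a" using c by (simp add: field_simps)
  qed
  show ?thesis
  proof (cases "s \<le> t")
    case True then show ?thesis using *[OF assms(2)] by simp
  next
    case False
    then show ?thesis using *[OF disc_curve_reverse[OF assms(2), of 0], of "-s" "-t"] by simp
  qed
qed

section \<open>Near-geodesics\<close>

lemma analytic_disc_lipschitz:
  fixes \<phi> :: "complex \<Rightarrow> complex ^ 'n"
  assumes "\<phi> \<in> analytic_discs S" "r < 1"
  shows "\<exists>L. L-lipschitz_on (cball 0 r) \<phi>"
proof -
  have "\<exists>B. \<forall>x\<in>cball 0 r. \<forall>y\<in>cball 0 r. cmod (\<phi> x $ i - \<phi> y $ i) \<le> B * cmod (x - y)" for i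
  proof -
    have sub: "cball 0 r \<subseteq> ball (0::complex) 1" using assms(2) by auto
    have h: "(\<lambda>\<zeta>. \<phi> \<zeta> $ i) holomorphic_on ball 0 1" by (rule analytic_discsD[OF assms(1)])
    have "continuous_on (cball 0 r) (deriv (\<lambda>\<zeta>. \<phi> \<zeta> $ i))"
      by (rule continuous_on_subset[OF holomorphic_on_imp_continuous_on[OF holomorphic_deriv[OF h open_ball]] sub])
    then have "bounded (deriv (\<lambda>\<zeta>. \<phi> \<zeta> $ i) ` cball 0 r)"
      by (intro compact_imp_bounded compact_continuous_image) auto
    then obtain B where B: "\<And>\<zeta>. \<zeta> \<in> cball 0 r \<Longrightarrow> cmod (deriv (\<lambda>\<zeta>. \<phi> \<zeta> $ i) \<zeta>) \<le> B"
      unfolding bounded_iff by blast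
    have "cmod (\<phi> x $ i - \<phi> y $ i) \<le> B * cmod (x - y)" if "x \<in> cball 0 r" "y \<in> cball 0 r" for x y
      by (rule field_differentiable_bound[OF convex_cball _ B that])
        (use holomorphic_derivI[OF h open_ball] sub in auto)
    then show ?thesis by blast
  qed
  then obtain B where B: "\<And>i x y. x \<in> cball 0 r \<Longrightarrow> y \<in> cball 0 r \<Longrightarrow>
      cmod (\<phi> x $ i - \<phi> y $ i) \<le> B i * cmod (x - y)"
    by metis
  have "(\<Sum>i\<in>UNIV. \<bar>B i\<bar>)-lipschitz_on (cball 0 r) \<phi>"
  proof (rule lipschitz_onI)
    fix x y :: complex assume xy: "x \<in> cball 0 r" "y \<in> cball 0 r"
    have "dist (\<phi> x) (\<phi> y) \<le> (\<Sum>i\<in>UNIV. cmod (\<phi> x $ i - \<phi> y $ i))"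
      by (simp add: dist_norm norm_vec_def L2_set_le_sum)
    also have "\<dots> \<le> (\<Sum>i\<in>UNIV. \<bar>B i\<bar> * cmod (x - y))"
      by (intro sum_mono order_trans[OF B[OF xy]] mult_right_mono) auto
    also have "\<dots> = (\<Sum>i\<in>UNIV. \<bar>B i\<bar>) * dist x y" by (simp add: sum_distrib_right dist_norm)
    finally show "dist (\<phi> x) (\<phi> y) \<le> (\<Sum>i\<in>UNIV. \<bar>B i\<bar>) * dist x y" .
  qed (simp add: sum_nonneg)
  then show ?thesis by blast
qed

lemma tanh_lipschitz: "\<bar>tanh x - tanh (y::real)\<bar> \<le> \<bar>x - y\<bar>"
proof -
  have "norm (tanh x - tanh y) \<le> 1 * norm (x - y)"
  proof (rule field_differentiable_bound[of UNIV tanh "\<lambda>x. 1 - tanh x ^ 2"])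
    show "(tanh has_field_derivative 1 - (tanh z)\<^sup>2) (at z)" for z :: real
      by (auto intro!: derivative_eq_intros)
    show "norm (1 - (tanh z)\<^sup>2) \<le> 1" for z :: real
    proof -
      have "(tanh z)\<^sup>2 \<le> 1"
        using tanh_real_lt_1[of z] tanh_real_gt_neg1[of z] by (simp add: abs_square_le_1 abs_le_iff)
      then show ?thesis using zero_le_power2[of "tanh z"] unfolding real_norm_def by linarith
    qed
  qed auto
  then show ?thesis by simp
qed

lemma disc_germ_lipschitz:
  assumes "disc_germ S {0..} f"
  shows "\<exists>d>0. \<exists>L. L-lipschitz_on {0..d} f"
proof -
  obtain \<phi> \<delta> where p: "\<phi> \<in> analytic_discs S" "\<delta> > 0" "\<And>h. 0 \<le> h \<Longrightarrow> h < \<delta> \<Longrightarrow> f h = \<phi> (of_real (tanh h))"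
    using assms unfolding disc_germ_def by fastforce
  obtain L where L: "L-lipschitz_on (cball 0 (1/2)) \<phi>" using analytic_disc_lipschitz[OF p(1), of "1/2"] by auto
  define d where "d = min (\<delta> / 2) (1 / 2)"
  have "L-lipschitz_on {0..d} f"
  proof (rule lipschitz_onI)
    fix x y assume xy: "x \<in> {0..d}" "y \<in> {0..d}"
    have t: "\<bar>tanh h\<bar> \<le> 1 / 2" if "h \<in> {0..d}" for h
      using tanh_lipschitz[of h 0] that by (auto simp: d_def)
    have "dist (f x) (f y) = dist (\<phi> (of_real (tanh x))) (\<phi> (of_real (tanh y)))"
      using p(2) p(3)[of x] p(3)[of y] xy by (auto simp: d_def)
    also have "\<dots> \<le> L * dist (complex_of_real (tanh x)) (of_real (tanh y))"
      using t[OF xy(1)] t[OF xy(2)] by (intro lipschitz_onD[OF L]) auto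
    also have "\<dots> \<le> L * dist x y"
      using tanh_lipschitz[of x y] lipschitz_on_nonneg[OF L]
      by (intro mult_left_mono) (auto simp: dist_norm simp flip: of_real_diff)
    finally show "dist (f x) (f y) \<le> L * dist x y" .
  qed (rule lipschitz_on_nonneg[OF L])
  then show ?thesis using p(2) by (intro exI[of _ d]) (auto simp: d_def)
qed

text \<open>Having some Lipschitz constant is a local property by the one-sided germs and passes to
  adjacent intervals with the larger constant, so the bisection principle applies.\<close>

lemma disc_curve_lipschitz:
  assumes \<sigma>: "disc_curve S \<sigma>" and ab: "a \<le> b"
  shows "\<exists>L. L-lipschitz_on {a..b} \<sigma>"
  using ab
proof (induction rule: Bolzano)
  case (trans u v w)
  then obtain L M where "L-lipschitz_on {u..v} \<sigma>" "M-lipschitz_on {v..w} \<sigma>" by blast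
  from lipschitz_on_concat_max[OF this] show ?case by auto
next
  case (local x)
  obtain d1 L where 1: "d1 > 0" "L-lipschitz_on {0..d1} (\<lambda>h. \<sigma> (x + h))"
    using \<sigma> disc_germ_lipschitz[of S "\<lambda>h. \<sigma> (x + h)"] by (auto simp: disc_curve_def)
  obtain d2 M where 2: "d2 > 0" "M-lipschitz_on {0..d2} (\<lambda>h. \<sigma> (x - h))"
    using \<sigma> disc_germ_lipschitz[of S "\<lambda>h. \<sigma> (x - h)"] by (auto simp: disc_curve_def)
  have "L-lipschitz_on {x..x + d1} \<sigma>"
  proof (rule lipschitz_onI)
    fix s t assume "s \<in> {x..x + d1}" "t \<in> {x..x + d1}"
    then show "dist (\<sigma> s) (\<sigma> t) \<le> L * dist s t"
      using lipschitz_onD[OF 1(2), of "s - x" "t - x"] by (auto simp: dist_real_def)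
  qed (rule lipschitz_on_nonneg[OF 1(2)])
  moreover have "M-lipschitz_on {x - d2..x} \<sigma>"
  proof (rule lipschitz_onI)
    fix s t assume "s \<in> {x - d2..x}" "t \<in> {x - d2..x}"
    then show "dist (\<sigma> s) (\<sigma> t) \<le> M * dist s t"
      using lipschitz_onD[OF 2(2), of "x - s" "x - t"] by (auto simp: dist_real_def abs_minus_commute)
  qed (rule lipschitz_on_nonneg[OF 2(2)])
  ultimately have *: "(max M L)-lipschitz_on {x - d2..x + d1} \<sigma>"
    using lipschitz_on_concat_max[of M "x - d2" x \<sigma> L "x + d1" \<sigma>] by simp
  show ?case
    using 1 2 by (intro exI[of _ "min d1 d2"] conjI allI impI exI[of _ "max M L"] lipschitz_on_subset[OF *]) auto
qed

lemma disc_curve_continuous_on: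
  assumes "disc_curve S \<sigma>"
  shows "continuous_on {a..b} \<sigma>"
proof (cases "a \<le> b")
  case True
  then show ?thesis using disc_curve_lipschitz[OF assms] lipschitz_on_continuous_on by blast
qed auto

lemma lipschitz_on_imp_abs_continuous_on:
  assumes "L-lipschitz_on I f"
  shows "abs_continuous_on I f"
  unfolding abs_continuous_on_def
proof (intro allI impI)
  fix e :: real assume e: "e > 0"
  have L: "0 \<le> L" by (rule lipschitz_on_nonneg[OF assms])
  show "\<exists>\<delta>>0. \<forall>(m::nat) a b.
       (\<forall>i<m. a i \<le> b i \<and> {a i..b i} \<subseteq> I) \<and>
       disjoint_family_on (\<lambda>i. {a i<..<b i}) {..<m} \<and>
       (\<Sum>i<m. b i - a i) < \<delta>
       \<longrightarrow> (\<Sum>i<m. dist (f (a i)) (f (b i))) < e"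
  proof (intro exI[of _ "e / (L + 1)"] conjI allI impI)
    fix m :: nat and a b :: "nat \<Rightarrow> real"
    assume *: "(\<forall>i<m. a i \<le> b i \<and> {a i..b i} \<subseteq> I) \<and>
       disjoint_family_on (\<lambda>i. {a i<..<b i}) {..<m} \<and> (\<Sum>i<m. b i - a i) < e / (L + 1)"
    have "(\<Sum>i<m. dist (f (a i)) (f (b i))) \<le> (\<Sum>i<m. L * (b i - a i))"
    proof (intro sum_mono)
      fix i assume "i \<in> {..<m}"
      then have "a i \<le> b i" "a i \<in> I" "b i \<in> I" using * by (auto simp: subset_iff)
      then show "dist (f (a i)) (f (b i)) \<le> L * (b i - a i)"
        using lipschitz_onD[OF assms, of "a i" "b i"] by (simp add: dist_real_def)
    qed
    also have "\<dots> = L * (\<Sum>i<m. b i - a i)" by (simp add: sum_distrib_left)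
    also have "\<dots> \<le> L * (e / (L + 1))" using * L by (intro mult_left_mono) auto
    also have "\<dots> < e" using L e by (simp add: field_simps)
    finally show "(\<Sum>i<m. dist (f (a i)) (f (b i))) < e" .
  qed (use L e in auto)
qed

lemma has_vector_derivative_vecI:
  fixes f :: "real \<Rightarrow> complex ^ 'n"
  assumes "\<And>i. ((\<lambda>x. f x $ i) has_vector_derivative v $ i) (at a)"
  shows "(f has_vector_derivative v) (at a)"
proof -
  have "((\<lambda>x. f x \<bullet> b) has_derivative (\<lambda>x. (x *\<^sub>R v) \<bullet> b)) (at a)" if B: "b \<in> Basis" for b
  proof -
    obtain i c where b: "b = axis i c" using B by (auto simp: Basis_vec_def)
    have "((\<lambda>x. f x $ i \<bullet> c) has_derivative (\<lambda>x. (x *\<^sub>R v $ i) \<bullet> c)) (at a)"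
      using assms[of i] unfolding has_vector_derivative_def by (rule has_derivative_inner_left)
    then show ?thesis by (simp add: b inner_axis)
  qed
  then show ?thesis unfolding has_vector_derivative_def has_derivative_componentwise_within[of f] by blast
qed

text \<open>As \<open>tanh\<close> has slope 1 at 0, the velocity is the derivative of the disc at
  0, and the disc itself with \<open>\<xi> = 1\<close> competes in the infimum.\<close>

lemma disc_germ_derivative:
  assumes "disc_germ S UNIV (\<lambda>h. \<sigma> (t + h))"
  obtains v where "(\<sigma> has_vector_derivative v) (at t)" "kobayashi_royden S (\<sigma> t) v \<le> 1"
proof -
  obtain \<phi> \<delta> where p: "\<phi> \<in> analytic_discs S" "\<delta> > 0"
    "\<And>h. \<bar>h\<bar> < \<delta> \<Longrightarrow> \<sigma> (t + h) = \<phi> (of_real (tanh h))"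
    using assms unfolding disc_germ_def by blast
  have "((\<lambda>x. \<phi> (of_real (tanh (x - t)))) has_vector_derivative disc_deriv \<phi> 0) (at t)"
  proof (rule has_vector_derivative_vecI)
    fix i
    have "((\<lambda>x. tanh (x - t)) has_real_derivative 1) (at t)"
      by (auto intro!: derivative_eq_intros)
    from has_vector_derivative_of_real[OF this]
    have 1: "((\<lambda>x. complex_of_real (tanh (x - t))) has_vector_derivative 1) (at t)" by simp
    have "((\<lambda>\<zeta>. \<phi> \<zeta> $ i) has_field_derivative deriv (\<lambda>\<zeta>. \<phi> \<zeta> $ i) 0) (at 0)"
      by (rule holomorphic_derivI[OF analytic_discsD(1)[OF p(1)] open_ball]) auto
    then have "((\<lambda>\<zeta>. \<phi> \<zeta> $ i) has_field_derivative deriv (\<lambda>\<zeta>. \<phi> \<zeta> $ i) 0) (at (of_real (tanh (t - t))))"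
      by simp
    from field_vector_diff_chain_at[OF 1 this]
    show "((\<lambda>x. \<phi> (of_real (tanh (x - t))) $ i) has_vector_derivative disc_deriv \<phi> 0 $ i) (at t)"
      by (simp add: o_def disc_deriv_def)
  qed
  then have d: "(\<sigma> has_vector_derivative disc_deriv \<phi> 0) (at t)"
  proof (rule has_vector_derivative_transform_within_open[where S = "ball t \<delta>"])
    fix x assume "x \<in> ball t \<delta>"
    then show "\<phi> (of_real (tanh (x - t))) = \<sigma> x"
      using p(3)[of "x - t"] by (simp add: dist_real_def abs_minus_commute)
  qed (use p in auto)
  have "kobayashi_royden S (\<sigma> t) (disc_deriv \<phi> 0) \<le> 1"
    unfolding kobayashi_royden_def
  proof (rule cInf_lower)
    show "1 \<in> {cmod \<xi> |\<xi>. \<exists>\<phi>'\<in>analytic_discs S. \<phi>' 0 = \<sigma> t \<and> \<xi> *s disc_deriv \<phi>' 0 = disc_deriv \<phi> 0}"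
      using p(1,2) p(3)[of 0] by (intro CollectI exI[of _ 1] conjI bexI[of _ \<phi>]) auto
  qed (auto intro: bdd_belowI[of _ 0])
  with d show ?thesis by (rule that)
qed

text \<open>Only a lower bound is imposed, the upper one being
  \<open>kobayashi_dist_disc_curve_le\<close>. The additive error 1 is the value of
  \<open>\<kappa>\<close> at which visibility is applied.\<close>

definition near_geodesic :: "(complex ^ 'n) set \<Rightarrow> real \<Rightarrow> (real \<Rightarrow> complex ^ 'n) \<Rightarrow> bool" where
  "near_geodesic S T \<sigma> \<longleftrightarrow> disc_curve S \<sigma> \<and>
    (\<forall>s\<in>{0..T}. \<forall>t\<in>{0..T}. \<bar>s - t\<bar> - 1 \<le> kobayashi_dist S (\<sigma> s) (\<sigma> t))"

lemma near_geodesic_imp_almost_geodesic: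
  assumes "cn_domain S" "near_geodesic S T \<sigma>" "0 \<le> T" "lam \<ge> 1"
  shows "almost_geodesic S lam 1 {0..T} \<sigma>"
  unfolding almost_geodesic_def
proof (intro conjI ballI)
  have \<sigma>: "disc_curve S \<sigma>" using assms(2) by (simp add: near_geodesic_def)
  show "\<sigma> ` {0..T} \<subseteq> S" using disc_curve_in[OF \<sigma>] by blast
  show "abs_continuous_on {0..T} \<sigma>"
    using disc_curve_lipschitz[OF \<sigma> assms(3)] lipschitz_on_imp_abs_continuous_on by blast
  obtain F where F: "finite F" "\<And>t. t \<notin> F \<Longrightarrow> disc_germ S UNIV (\<lambda>h. \<sigma> (t + h))"
    using \<sigma> unfolding disc_curve_def by blast
  have "F \<in> null_sets lebesgue" using F(1) by (intro null_sets_completionI finite_imp_null_set_lborel)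
  then have "AE t in lebesgue. t \<notin> F" by (rule AE_not_in)
  then show "AE t in lebesgue. t \<in> {0..T} \<longrightarrow>
      (\<exists>v. (\<sigma> has_vector_derivative v) (at t within {0..T}) \<and> kobayashi_royden S (\<sigma> t) v \<le> lam)"
  proof eventually_elim
    case (elim t)
    then obtain v where "(\<sigma> has_vector_derivative v) (at t)" "kobayashi_royden S (\<sigma> t) v \<le> 1"
      using disc_germ_derivative[OF F(2)] by blast
    then show ?case using assms(4) by (intro impI exI[of _ v]) (auto intro: has_vector_derivative_at_within)
  qed
  fix s t assume st: "s \<in> {0..T}" "t \<in> {0..T}"
  have "1 / lam * \<bar>s - t\<bar> \<le> \<bar>s - t\<bar>" using assms(4) by (intro mult_left_le_one_le) auto
  then show "1 / lam * \<bar>s - t\<bar> - 1 \<le> kobayashi_dist S (\<sigma> s) (\<sigma> t)"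
    using assms(2) st unfolding near_geodesic_def by fastforce
  have "\<bar>s - t\<bar> \<le> lam * \<bar>s - t\<bar>" using mult_right_mono[OF assms(4), of "\<bar>s - t\<bar>"] by simp
  then show "kobayashi_dist S (\<sigma> s) (\<sigma> t) \<le> lam * \<bar>s - t\<bar> + 1"
    by (intro add_increasing2 order_trans[OF kobayashi_dist_disc_curve_le[OF assms(1) \<sigma>, of s t]]) auto
qed

lemma near_geodesic_shift:
  assumes "near_geodesic S T \<sigma>" "0 \<le> a" "a + T' \<le> T"
  shows "near_geodesic S T' (\<lambda>t. \<sigma> (a + t))"
  using assms disc_curve_shift[of S \<sigma> a] unfolding near_geodesic_def
  by (auto dest!: bspec[where x = "a + _"])

lemma near_geodesic_reverse:
  assumes "near_geodesic S T \<sigma>"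
  shows "near_geodesic S T (\<lambda>t. \<sigma> (T - t))"
  unfolding near_geodesic_def
proof (intro conjI ballI)
  show "disc_curve S (\<lambda>t. \<sigma> (T - t))"
    using assms disc_curve_reverse unfolding near_geodesic_def by blast
  fix s t assume "s \<in> {0..T}" "t \<in> {0..T}"
  then have "T - s \<in> {0..T}" "T - t \<in> {0..T}" by auto
  then have "\<bar>(T - s) - (T - t)\<bar> - 1 \<le> kobayashi_dist S (\<sigma> (T - s)) (\<sigma> (T - t))"
    using assms unfolding near_geodesic_def by blast
  then show "\<bar>s - t\<bar> - 1 \<le> kobayashi_dist S (\<sigma> (T - s)) (\<sigma> (T - t))" by (simp add: abs_minus_commute)
qed

lemma kobayashi_hyperbolicD:
  assumes "kobayashi_hyperbolic S"
  shows "kobayashi_dist S x y = kobayashi_dist S y x"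
    "x \<in> S \<Longrightarrow> y \<in> S \<Longrightarrow> x \<noteq> y \<Longrightarrow> 0 < kobayashi_dist S x y"
proof -
  interpret Metric_space S "kobayashi_dist S" using assms by (simp add: kobayashi_hyperbolic_def)
  show "kobayashi_dist S x y = kobayashi_dist S y x" by (rule commute)
  show "x \<in> S \<Longrightarrow> y \<in> S \<Longrightarrow> x \<noteq> y \<Longrightarrow> 0 < kobayashi_dist S x y" by simp
qed

text \<open>A curve from a chain of length below the distance plus \<open>e\<close> loses less than
  \<open>e\<close> on every subarc, by the triangle inequality; hyperbolicity supplies symmetry.
  Keeping \<open>e\<close> free lets \<open>T\<close> come arbitrarily close to the
  distance.\<close>

lemma near_geodesic_exists:
  assumes S: "cn_domain S" "kobayashi_hyperbolic S" and zw: "z \<in> S" "w \<in> S" and e: "0 < e" "e \<le> 1"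
  obtains \<sigma> T where "near_geodesic S T \<sigma>" "\<sigma> 0 = z" "\<sigma> T = w" "0 \<le> T" "T < kobayashi_dist S z w + e"
proof -
  obtain l where l: "disc_chain S z w l" "l < kobayashi_dist S z w + e"
    using disc_chain_near_inf[OF S(1) zw, of "kobayashi_dist S z w + e"] e by auto
  obtain \<sigma> where \<sigma>: "disc_curve S \<sigma>" "\<sigma> 0 = z" "\<sigma> l = w" using disc_curve_of_chain[OF l(1)] by blast
  have *: "\<bar>s - t\<bar> - 1 \<le> kobayashi_dist S (\<sigma> s) (\<sigma> t)" if "0 \<le> s" "s \<le> t" "t \<le> l" for s t
  proof -
    have "kobayashi_dist S z w \<le> kobayashi_dist S z (\<sigma> s) + (kobayashi_dist S (\<sigma> s) (\<sigma> t) + kobayashi_dist S (\<sigma> t) w)"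
      using kobayashi_dist_triangle[OF S(1), of z "\<sigma> s" w] kobayashi_dist_triangle[OF S(1), of "\<sigma> s" "\<sigma> t" w]
        disc_curve_in[OF \<sigma>(1)] zw by force
    then show ?thesis
      using kobayashi_dist_disc_curve_le[OF S(1) \<sigma>(1), of 0 s] kobayashi_dist_disc_curve_le[OF S(1) \<sigma>(1), of t l]
        that l(2) e \<sigma>(2,3) by simp
  qed
  have "near_geodesic S l \<sigma>"
    unfolding near_geodesic_def
  proof (intro conjI ballI)
    fix s t assume "s \<in> {0..l}" "t \<in> {0..l}"
    then show "\<bar>s - t\<bar> - 1 \<le> kobayashi_dist S (\<sigma> s) (\<sigma> t)"
      using *[of s t] *[of t s] kobayashi_hyperbolicD(1)[OF S(2), of "\<sigma> s" "\<sigma> t"]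
      by (cases "s \<le> t") (auto simp: abs_minus_commute)
  qed (rule \<sigma>(1))
  then show ?thesis using that \<sigma> l disc_chain_in[OF l(1)] by blast
qed

text \<open>
  Barth's theorem: the Kobayashi distance of a hyperbolic domain, being inner, induces the Euclidean
  topology, since a curve that leaves a neighbourhood of \<open>K\<close> crosses a compact level set.
\<close>

lemma kobayashi_dist_compact_lower_bound:
  assumes S: "cn_domain S" "kobayashi_hyperbolic S" and K: "compact K" "K \<subseteq> U" and U: "open U" "U \<subseteq> S"
  shows "\<exists>r>0. \<forall>q\<in>K. \<forall>u\<in>S - U. r \<le> kobayashi_dist S q u"
proof (cases "K = {}")
  case True then show ?thesis by (auto intro: exI[of _ 1])
next
  case False
  obtain e where e: "e > 0" "{x. infdist x K \<le> e} \<subseteq> U"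
    using compact_in_open_separated[OF False K(1) U(1) K(2)] by blast
  define L where "L = {x. infdist x K = e}"
  have "L = {x. infdist x K \<le> e} \<inter> {x. infdist x K \<in> {e}}" by (auto simp: L_def)
  moreover have "closed {x. infdist x K \<in> {e}}"
    by (simp add: closed_Collect_eq continuous_on_infdist)
  ultimately have L: "compact L" using compact_infdist_le[OF False K(1) e(1)] by auto
  have LU: "L \<subseteq> U" using e(2) by (auto simp: L_def)
  \<comment> \<open>A nearly shortest curve from \<open>q\<close> to \<open>u\<close> crosses
    \<open>L\<close>, at a point no farther from \<open>q\<close> than the elapsed time.\<close>
  have cross: "\<exists>p\<in>L. kobayashi_dist S q p < kobayashi_dist S q u + \<epsilon>"
    if q: "q \<in> K" and u: "u \<in> S - U" and \<epsilon>: "0 < \<epsilon>" "\<epsilon> \<le> 1" for q u \<epsilon>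
  proof -
    have "q \<in> S" "u \<in> S" using q u K U by auto
    then obtain \<sigma> T where \<sigma>: "near_geodesic S T \<sigma>" "\<sigma> 0 = q" "\<sigma> T = u" "0 \<le> T" "T < kobayashi_dist S q u + \<epsilon>"
      using near_geodesic_exists[OF S _ _ \<epsilon>] by metis
    have dc: "disc_curve S \<sigma>" using \<sigma>(1) by (simp add: near_geodesic_def)
    have "infdist (\<sigma> 0) K \<le> e" using \<sigma> q e by auto
    moreover have "\<sigma> T \<notin> {x. infdist x K \<le> e}" using \<sigma>(3) u e(2) by blast
    then have "e \<le> infdist (\<sigma> T) K" by simp
    moreover have "continuous_on {0..T} (\<lambda>t. infdist (\<sigma> t) K)"
      by (intro continuous_on_infdist disc_curve_continuous_on[OF dc])
    ultimately obtain s where s: "0 \<le> s" "s \<le> T" "infdist (\<sigma> s) K = e"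
      using IVT'[of "\<lambda>t. infdist (\<sigma> t) K" 0 e T] \<sigma>(4) by auto
    have "kobayashi_dist S q (\<sigma> s) \<le> s"
      using kobayashi_dist_disc_curve_le[OF S(1) dc, of 0 s] \<sigma>(2) s(1) by simp
    then show ?thesis using s \<sigma>(5) by (intro bexI[of _ "\<sigma> s"]) (auto simp: L_def)
  qed
  show ?thesis
  proof (cases "L = {}")
    case True
    \<comment> \<open>A point outside \<open>U\<close> would force a crossing of the empty level
      set.\<close>
    then have "S - U = {}" using cross[of _ _ 1] False by fastforce
    then show ?thesis by (auto intro: exI[of _ 1])
  next
    case L0: False
    have "K \<times> L \<subseteq> S \<times> S" using K LU U by auto
    then have cont: "continuous_on (K \<times> L) (\<lambda>(x, y). kobayashi_dist S x y)"
      by (rule continuous_on_subset[OF kobayashi_dist_continuous_on[OF S(1)]])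
    have "K \<times> L \<noteq> {}" using False L0 by simp
    from continuous_attains_inf[OF compact_Times[OF K(1) L] this cont]
    obtain m where m: "m \<in> K \<times> L" "\<And>p. p \<in> K \<times> L \<Longrightarrow>
        (\<lambda>(x, y). kobayashi_dist S x y) m \<le> (\<lambda>(x, y). kobayashi_dist S x y) p"
      by blast
    obtain q0 p0 where qp: "m = (q0, p0)" by force
    \<comment> \<open>\<open>L\<close> has positive Euclidean distance \<open>e\<close> from
      \<open>K\<close>, so the minimum is attained at distinct points and is positive.\<close>
    have "q0 \<noteq> p0" using m(1) qp e(1) by (auto simp: L_def)
    then have pos: "0 < kobayashi_dist S q0 p0"
      using m(1) qp K LU U by (intro kobayashi_hyperbolicD[OF S(2)]) auto
    have "kobayashi_dist S q0 p0 \<le> kobayashi_dist S q u" if qu: "q \<in> K" "u \<in> S - U" for q u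
    proof (rule field_le_epsilon)
      fix \<epsilon> :: real assume "\<epsilon> > 0"
      then obtain p where "p \<in> L" "kobayashi_dist S q p < kobayashi_dist S q u + min \<epsilon> 1"
        using cross[OF qu, of "min \<epsilon> 1"] by auto
      then show "kobayashi_dist S q0 p0 \<le> kobayashi_dist S q u + \<epsilon>"
        using m(2)[of "(q, p)"] qu(1) qp by auto
    qed
    then show ?thesis using pos by blast
  qed
qed

section \<open>Localization\<close>

text \<open>With \<open>E = exp (- 2 * s)\<close>, \<open>coth s - 1\<close> equals
  \<open>2 * E / (1 - E)\<close>. The denominator is at least \<open>q\<close>, while
  \<open>E\<close> decays like \<open>exp (- \<bar>x\<bar>)\<close>, which a Taylor bound compares
  with \<open>1 / (1 + x\<^sup>2)\<close>, the derivative of \<open>arctan\<close>.\<close>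

lemma coth_max_bound:
  assumes "(0::real) < r"
  obtains A where "\<And>x. 1 / tanh (max r (\<bar>x\<bar> / 2 - c)) < 1 + A / (1 + x\<^sup>2)" "0 < A"
proof -
  define q where "q = 1 - exp (- 2 * r)"
  have q: "0 < q" using assms by (simp add: q_def)
  \<comment> \<open>The summand 1 makes the final inequality strict, as the integrated length
    estimate demands.\<close>
  define A where "A = 4 * exp (2 * c) / q + 1"
  have "1 / tanh (max r (\<bar>x\<bar> / 2 - c)) < 1 + A / (1 + x\<^sup>2)" for x
  proof -
    define s where "s = max r (\<bar>x\<bar> / 2 - c)"
    define E where "E = exp (- 2 * s)"
    have "E \<le> exp (- 2 * r)" by (simp add: E_def s_def)
    then have E: "0 < E" "q \<le> 1 - E" by (auto simp: q_def E_def)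
    have x2: "0 < 1 + x\<^sup>2" by (simp add: add_pos_nonneg)
    have "(1 + x\<^sup>2) / 2 \<le> 1 + \<bar>x\<bar> + \<bar>x\<bar>\<^sup>2 / 2" by simp
    also have "\<dots> \<le> exp \<bar>x\<bar>" by (rule exp_lower_Taylor_quadratic) simp
    finally have ex: "(1 + x\<^sup>2) / 2 \<le> exp \<bar>x\<bar>" .
    have "\<bar>x\<bar> / 2 - c \<le> s" unfolding s_def by (rule max.cobounded2)
    then have "E \<le> exp (2 * c - \<bar>x\<bar>)" by (simp add: E_def)
    also have "\<dots> = exp (2 * c) / exp \<bar>x\<bar>" by (simp add: exp_diff)
    also have "\<dots> \<le> exp (2 * c) / ((1 + x\<^sup>2) / 2)"
      using x2 by (intro divide_left_mono ex) auto
    finally have E2: "E \<le> 2 * exp (2 * c) / (1 + x\<^sup>2)" by (simp add: mult.commute)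
    have "1 / tanh s = 1 + 2 * E / (1 - E)"
      using E q unfolding tanh_real_altdef E_def[symmetric] by (simp add: field_simps)
    also have "2 * E / (1 - E) \<le> 2 * (2 * exp (2 * c) / (1 + x\<^sup>2)) / q"
      using E q E2 by (intro frac_le mult_left_mono) auto
    also have "\<dots> = (A - 1) / (1 + x\<^sup>2)" using x2 q by (simp add: A_def field_simps)
    also have "\<dots> < A / (1 + x\<^sup>2)" using x2 by (simp add: divide_strict_right_mono)
    finally show ?thesis by (simp add: s_def)
  qed
  moreover have "0 < A" using q by (simp add: A_def add_pos_pos)
  ultimately show ?thesis by (rule that)
qed

text \<open>\<open>C\<close> stands for the closure of \<open>W\<close>. The condition
  \<open>near\<close> says that within \<open>\<Omega>\<close> the boundary of \<open>U\<close>
  stays away from the \<open>3 * e\<close>-neighbourhood of \<open>C\<close>.\<close>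

locale visible_subdomain =
  fixes \<Omega> U C :: "(complex ^ 'n) set" and lam e :: real
  assumes \<Omega>: "cn_domain \<Omega>" and hyp: "kobayashi_hyperbolic \<Omega>" and U: "cn_domain U" and U_sub: "U \<subseteq> \<Omega>"
    and lam: "lam \<ge> 1"
    and visible: "\<And>\<zeta> \<eta>. \<lbrakk>\<zeta> \<in> frontier U \<inter> frontier \<Omega>; \<eta> \<in> frontier U \<inter> frontier \<Omega>; \<zeta> \<noteq> \<eta>\<rbrakk>
           \<Longrightarrow> visible_pair \<Omega> lam \<zeta> \<eta>"
    and C: "compact C" "C \<noteq> {}" and e: "0 < e"
    and near: "\<And>x. x \<in> closure U \<Longrightarrow> x \<in> \<Omega> \<Longrightarrow> infdist x C \<le> 3 * e \<Longrightarrow> x \<in> U"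
begin

text \<open>Three widths occur: 0 for the points to be compared, \<open>2 * e\<close> for the length
  estimate, and \<open>3 * e\<close> for bounding distances from the middle collar to the complement
  of \<open>U\<close>.\<close>

definition collar :: "real \<Rightarrow> (complex ^ 'n) set" where
  "collar \<rho> = {x \<in> U. infdist x C \<le> \<rho>}"

section \<open>Exits from the collars, and visibility\<close>

lemma open_domains: "open \<Omega>" "open U"
  using \<Omega> U by (auto simp: cn_domain_def)

text \<open>By \<open>near\<close>, a curve in \<open>\<Omega>\<close> cannot leave \<open>U\<close>
  while close to \<open>C\<close>, so it leaves the collar through a level set of
  \<open>infdist\<close>. Unless the curve starts on that level set, \<open>s\<close> is the first
  time outside the open set \<open>V\<close>.\<close>

lemma exit_time:
  assumes \<sigma>: "disc_curve \<Omega> \<sigma>" and t: "0 \<le> t" and \<rho>: "\<rho> \<le> 3 * e"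
    and st: "\<sigma> 0 \<in> collar \<rho>" "\<sigma> t \<notin> collar \<rho>"
  obtains s where "0 \<le> s" "s \<le> t" "infdist (\<sigma> s) C = \<rho>" "\<And>x. 0 \<le> x \<Longrightarrow> x \<le> s \<Longrightarrow> \<sigma> x \<in> collar \<rho>"
proof (cases "infdist (\<sigma> 0) C = \<rho>")
  case True
  then show ?thesis using that[of 0] t st by auto
next
  case False
  define V where "V = U \<inter> {x. infdist x C < \<rho>}"
  have "open V" unfolding V_def
    by (intro open_Int open_domains open_Collect_less continuous_intros continuous_on_infdist)
  have cont: "continuous_on {0..t} \<sigma>" by (rule disc_curve_continuous_on[OF \<sigma>])
  define A where "A = {0..t} \<inter> \<sigma> -` (- V)"
  have "closed A" unfolding A_def
    by (rule continuous_closed_preimage[OF cont]) (use \<open>open V\<close> in auto)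
  have tA: "t \<in> A" using t st by (auto simp: A_def V_def collar_def)
  have bdd: "bdd_below A" by (rule bdd_belowI[of _ 0]) (auto simp: A_def)
  define s where "s = Inf A"
  have sA: "s \<in> A" unfolding s_def by (rule closed_contains_Inf) (use tA bdd \<open>closed A\<close> in auto)
  have V0: "\<sigma> 0 \<in> V" using st False by (auto simp: V_def collar_def)
  have s: "0 \<le> s" "s \<le> t" "s \<noteq> 0" using sA V0 by (auto simp: A_def)
  have before: "\<sigma> x \<in> V" if "0 \<le> x" "x < s" for x
  proof (rule ccontr)
    assume "\<sigma> x \<notin> V"
    then have "x \<in> A" using that s by (auto simp: A_def)
    then show False using cInf_lower[OF _ bdd, of x] that by (simp add: s_def)
  qed
  have cl: "closure {0..<s} = {0..s}" using s by simp
  \<comment> \<open>As a limit of earlier points, \<open>\<sigma> s\<close> lies in the closure of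
    \<open>U\<close>; \<open>near\<close> then puts it into \<open>U\<close>.\<close>
  have "\<sigma> ` closure {0..<s} \<subseteq> closure U \<inter> {x. infdist x C \<le> \<rho>}"
  proof (rule image_closure_subset)
    show "continuous_on (closure {0..<s}) \<sigma>" unfolding cl by (rule disc_curve_continuous_on[OF \<sigma>])
    show "closed (closure U \<inter> {x. infdist x C \<le> \<rho>})"
      by (intro closed_Int closed_closure closed_Collect_le continuous_intros continuous_on_infdist)
    show "\<sigma> ` {0..<s} \<subseteq> closure U \<inter> {x. infdist x C \<le> \<rho>}"
      using before closure_subset[of U] by (force simp: V_def)
  qed
  then have "\<sigma> s \<in> closure U" "infdist (\<sigma> s) C \<le> \<rho>" using s unfolding cl by (auto simp: image_subset_iff)
  moreover from this have "\<sigma> s \<in> U" using near disc_curve_in[OF \<sigma>] \<rho> by force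
  ultimately have "infdist (\<sigma> s) C = \<rho>" "\<sigma> s \<in> collar \<rho>" using sA by (auto simp: A_def V_def collar_def)
  moreover have "\<sigma> x \<in> collar \<rho>" if "0 \<le> x" "x < s" for x
    using before[OF that] by (auto simp: V_def collar_def)
  ultimately show ?thesis using that[of s] s by (metis order_le_less)
qed

text \<open>Otherwise near-geodesics avoid the members of a compact exhaustion of
  \<open>\<Omega>\<close>. Limits of their end points lie on both boundaries and are distinct, as
  their distances to \<open>C\<close> differ; this contradicts visibility.\<close>

lemma near_geodesics_meet_compact:
  assumes r: "0 \<le> r" "r < r'" "r' \<le> 3 * e"
  shows "\<exists>K. compact K \<and> K \<subseteq> \<Omega> \<and> (\<forall>T \<sigma>. 0 \<le> T \<and> near_geodesic \<Omega> T \<sigma> \<and> \<sigma> 0 \<in> collar r \<and>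
    \<sigma> T \<in> U \<and> infdist (\<sigma> T) C = r' \<longrightarrow> \<sigma> ` {0..T} \<inter> K \<noteq> {})"
proof (rule ccontr)
  assume neg: "\<not> ?thesis"
  obtain K where K: "\<And>n::nat. compact (K n)" "\<And>n. K n \<subseteq> \<Omega>"
    "\<And>L. compact L \<Longrightarrow> L \<subseteq> \<Omega> \<Longrightarrow> \<exists>N. \<forall>n\<ge>N. L \<subseteq> K n"
    using open_Union_compact_subsets[OF open_domains(1)] by metis
  have "\<forall>n. \<exists>T \<sigma>. 0 \<le> T \<and> near_geodesic \<Omega> T \<sigma> \<and> \<sigma> 0 \<in> collar r \<and>
    \<sigma> T \<in> U \<and> infdist (\<sigma> T) C = r' \<and> \<sigma> ` {0..T} \<inter> K n = {}"
    using neg K(1,2) by blast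
  then obtain T \<sigma> where \<sigma>: "\<And>n. 0 \<le> T n" "\<And>n. near_geodesic \<Omega> (T n) (\<sigma> n)" "\<And>n. \<sigma> n 0 \<in> collar r"
    "\<And>n. \<sigma> n (T n) \<in> U" "\<And>n. infdist (\<sigma> n (T n)) C = r'" "\<And>n. \<sigma> n ` {0..T n} \<inter> K n = {}"
    by metis
  define D where "D = closure U \<inter> {x. infdist x C \<le> r'}"
  have D: "compact D" unfolding D_def
    by (rule closed_Int_compact[OF closed_closure compact_infdist_le[OF C(2,1)]]) (use r in auto)
  have "(\<sigma> n 0, \<sigma> n (T n)) \<in> D \<times> D" for n
    using \<sigma>(3,4,5)[of n] r closure_subset[of U] by (auto simp: D_def collar_def)
  then obtain l \<phi> where l: "l \<in> D \<times> D" and \<phi>: "strict_mono (\<phi> :: nat \<Rightarrow> nat)"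
    and lim: "((\<lambda>n. (\<sigma> n 0, \<sigma> n (T n))) \<circ> \<phi>) \<longlonglongrightarrow> l"
    using compact_Times[OF D D] unfolding compact_def by (metis (no_types, lifting))
  obtain \<zeta> \<eta> where l_eq: "l = (\<zeta>, \<eta>)" by force
  have lim: "(\<lambda>n. \<sigma> (\<phi> n) 0) \<longlonglongrightarrow> \<zeta>" "(\<lambda>n. \<sigma> (\<phi> n) (T (\<phi> n))) \<longlonglongrightarrow> \<eta>"
    using tendsto_fst[OF lim] tendsto_snd[OF lim] by (simp_all add: l_eq o_def)
  have late: "\<forall>\<^sub>F n in sequentially. L \<subseteq> K (\<phi> n)" if L: "compact L" "L \<subseteq> \<Omega>" for L
  proof -
    obtain N where N: "\<forall>n\<ge>N. L \<subseteq> K n" using K(3)[OF L] by blast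
    show ?thesis
      using eventually_ge_at_top[of N]
    proof eventually_elim
      case (elim n)
      then have "N \<le> \<phi> n" using seq_suble[OF \<phi>, of n] by linarith
      then show ?case using N by blast
    qed
  qed
  \<comment> \<open>A limit inside \<open>\<Omega>\<close> would have a closed ball around it that
    the exhaustion eventually swallows, while the points stay outside the exhaustion.\<close>
  have out: "x \<notin> \<Omega>" if x: "(\<lambda>n. y n) \<longlonglongrightarrow> x" "\<And>n. y n \<notin> K (\<phi> n)" for x y
  proof
    assume "x \<in> \<Omega>"
    then obtain d where d: "d > 0" "cball x d \<subseteq> \<Omega>" using open_domains(1) open_contains_cball by blast
    have "\<forall>\<^sub>F n in sequentially. y n \<in> ball x d"
      using x(1) d(1) by (intro topological_tendstoD[OF x(1)]) auto
    with late[OF compact_cball d(2)] have "\<forall>\<^sub>F n in sequentially. False"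
      by eventually_elim (use x(2) in \<open>force simp: subset_iff\<close>)
    then show False by simp
  qed
  have "\<zeta> \<notin> \<Omega>" by (rule out[OF lim(1)]) (use \<sigma>(6,1) in force)
  moreover have "\<eta> \<notin> \<Omega>" by (rule out[OF lim(2)]) (use \<sigma>(6,1) in force)
  moreover have "\<zeta> \<in> closure U" "\<eta> \<in> closure U" using l by (auto simp: l_eq D_def)
  ultimately have fr: "\<zeta> \<in> frontier U \<inter> frontier \<Omega>" "\<eta> \<in> frontier U \<inter> frontier \<Omega>"
    using open_domains U_sub closure_mono[OF U_sub] by (auto simp: frontier_def interior_open)
  have "(\<lambda>n. infdist (\<sigma> (\<phi> n) 0) C) \<longlonglongrightarrow> infdist \<zeta> C" by (intro tendsto_infdist lim)
  then have "infdist \<zeta> C \<le> r"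
    by (rule tendsto_upperbound) (use \<sigma>(3) in \<open>auto simp: collar_def\<close>)
  moreover have "(\<lambda>n. infdist (\<sigma> (\<phi> n) (T (\<phi> n))) C) \<longlonglongrightarrow> infdist \<eta> C" by (intro tendsto_infdist lim)
  then have "infdist \<eta> C = r'" using \<sigma>(5) by (simp add: LIMSEQ_const_iff)
  ultimately have "\<zeta> \<noteq> \<eta>" using r by auto
  from visible[OF fr this] obtain V1 V2 L where V: "openin (top_of_set (closure \<Omega>)) V1" "\<zeta> \<in> V1"
    "openin (top_of_set (closure \<Omega>)) V2" "\<eta> \<in> V2" and L: "compact L" "L \<subseteq> \<Omega>"
    and hit: "\<And>\<sigma> T. T \<ge> 0 \<and> almost_geodesic \<Omega> lam 1 {0..T} \<sigma> \<and> \<sigma> 0 \<in> V1 \<and> \<sigma> T \<in> V2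
          \<Longrightarrow> \<sigma> ` {0..T} \<inter> L \<noteq> {}"
    unfolding visible_pair_def using zero_less_one by metis
  obtain O1 O2 where O: "open O1" "V1 = closure \<Omega> \<inter> O1" "open O2" "V2 = closure \<Omega> \<inter> O2"
    using V by (auto simp: openin_open)
  have "\<forall>\<^sub>F n in sequentially. \<sigma> (\<phi> n) 0 \<in> O1" "\<forall>\<^sub>F n in sequentially. \<sigma> (\<phi> n) (T (\<phi> n)) \<in> O2"
    using lim V O by (auto intro: topological_tendstoD)
  with late[OF L] have "\<forall>\<^sub>F n in sequentially. False"
  proof eventually_elim
    case (elim n)
    have "\<sigma> (\<phi> n) t \<in> closure \<Omega>" for t
      using \<sigma>(2)[of "\<phi> n"] disc_curve_in closure_subset[of \<Omega>] unfolding near_geodesic_def by blast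
    then have "\<sigma> (\<phi> n) ` {0..T (\<phi> n)} \<inter> L \<noteq> {}"
      using elim O \<sigma>(1) near_geodesic_imp_almost_geodesic[OF \<Omega> \<sigma>(2) \<sigma>(1) lam] by (intro hit) auto
    then show False using \<sigma>(6)[of "\<phi> n"] elim by blast
  qed
  then show False by simp
qed

text \<open>Cutting at the exit time gives a near-geodesic that ends on the level set
  \<open>r'\<close> and so meets a compact subset of \<open>\<Omega>\<close>. Its part in the
  closure of \<open>U\<close> near \<open>C\<close> is compact in \<open>U\<close>, by
  \<open>near\<close>.\<close>

lemma leaving_near_geodesics_meet_compact:
  assumes r: "0 \<le> r" "r < r'" "r' \<le> 3 * e"
  obtains K where "compact K" "K \<subseteq> U"
    "\<And>T \<sigma> t. near_geodesic \<Omega> T \<sigma> \<Longrightarrow> \<sigma> 0 \<in> collar r \<Longrightarrow> 0 \<le> t \<Longrightarrow> t \<le> T \<Longrightarrow> \<sigma> t \<notin> collar r' \<Longrightarrow>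
      \<exists>s. 0 \<le> s \<and> s \<le> t \<and> \<sigma> s \<in> K \<and> (\<forall>x\<in>{0..s}. \<sigma> x \<in> collar r')"
proof -
  obtain K where K: "compact K" "K \<subseteq> \<Omega>"
    "\<And>T \<sigma>. 0 \<le> T \<and> near_geodesic \<Omega> T \<sigma> \<and> \<sigma> 0 \<in> collar r \<and>
      \<sigma> T \<in> U \<and> infdist (\<sigma> T) C = r' \<Longrightarrow> \<sigma> ` {0..T} \<inter> K \<noteq> {}"
    using near_geodesics_meet_compact[OF r] by metis
  define D where "D = closure U \<inter> {x. infdist x C \<le> r'} \<inter> K"
  have "compact D" unfolding D_def
    by (rule closed_Int_compact[OF closed_Int K(1)])
      (auto intro!: closed_Collect_le continuous_intros continuous_on_infdist)
  moreover have "D \<subseteq> U" using K(2) near r by (auto simp: D_def)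
  moreover have "\<exists>s. 0 \<le> s \<and> s \<le> t \<and> \<sigma> s \<in> D \<and> (\<forall>x\<in>{0..s}. \<sigma> x \<in> collar r')"
    if \<sigma>: "near_geodesic \<Omega> T \<sigma>" "\<sigma> 0 \<in> collar r" "0 \<le> t" "t \<le> T" "\<sigma> t \<notin> collar r'" for T \<sigma> t
  proof -
    have "disc_curve \<Omega> \<sigma>" "\<sigma> 0 \<in> collar r'" using \<sigma> r by (auto simp: near_geodesic_def collar_def)
    from exit_time[OF this(1) \<sigma>(3) r(3) this(2) \<sigma>(5)] obtain s where s: "0 \<le> s" "s \<le> t"
      "infdist (\<sigma> s) C = r'" "\<And>x. 0 \<le> x \<Longrightarrow> x \<le> s \<Longrightarrow> \<sigma> x \<in> collar r'" by blast
    have "near_geodesic \<Omega> s \<sigma>" using near_geodesic_shift[OF \<sigma>(1), of 0 s] s \<sigma>(4) by simp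
    then have "\<sigma> ` {0..s} \<inter> K \<noteq> {}"
      using s(4)[of s] s \<sigma>(2) by (intro K(3)) (auto simp: collar_def)
    then obtain x where x: "0 \<le> x" "x \<le> s" "\<sigma> x \<in> K" by auto
    have "\<sigma> x \<in> D" using s(4)[OF x(1,2)] x(3) closure_subset[of U] by (auto simp: D_def collar_def)
    then show ?thesis using x s by (intro exI[of _ x]) auto
  qed
  ultimately show ?thesis by (rule that)
qed

text \<open>A near-geodesic from \<open>z\<close> to a point outside \<open>U\<close> meets
  \<open>K\<close> on its way, and \<open>K\<close> is within bounded distance of
  \<open>p\<close>.\<close>

lemma kobayashi_dist_to_complement_ge:
  assumes p: "p \<in> \<Omega>"
  obtains B where "\<And>z u. z \<in> collar (2 * e) \<Longrightarrow> u \<in> \<Omega> - U \<Longrightarrow>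
    kobayashi_dist \<Omega> z p - B \<le> kobayashi_dist \<Omega> z u"
proof -
  obtain K where K: "compact K" "K \<subseteq> U"
    "\<And>T \<sigma> t. near_geodesic \<Omega> T \<sigma> \<Longrightarrow> \<sigma> 0 \<in> collar (2 * e) \<Longrightarrow> 0 \<le> t \<Longrightarrow> t \<le> T \<Longrightarrow> \<sigma> t \<notin> collar (3 * e) \<Longrightarrow>
      \<exists>s. 0 \<le> s \<and> s \<le> t \<and> \<sigma> s \<in> K \<and> (\<forall>x\<in>{0..s}. \<sigma> x \<in> collar (3 * e))"
    using leaving_near_geodesics_meet_compact[of "2 * e" "3 * e"] e by auto
  have "continuous_on (K \<times> {p}) (\<lambda>(x, y). kobayashi_dist \<Omega> x y)"
    by (rule continuous_on_subset[OF kobayashi_dist_continuous_on[OF \<Omega>]]) (use K U_sub p in auto)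
  then have "bounded ((\<lambda>(x, y). kobayashi_dist \<Omega> x y) ` (K \<times> {p}))"
    using K(1) by (intro compact_imp_bounded compact_continuous_image compact_Times) auto
  then obtain B where B: "\<And>q. q \<in> K \<Longrightarrow> kobayashi_dist \<Omega> q p \<le> B"
    unfolding bounded_iff by (force simp: abs_le_iff)
  have "kobayashi_dist \<Omega> z p - (B + 1) \<le> kobayashi_dist \<Omega> z u" if zu: "z \<in> collar (2 * e)" "u \<in> \<Omega> - U" for z u
  proof -
    have z: "z \<in> \<Omega>" using zu U_sub by (auto simp: collar_def)
    obtain \<sigma> T where \<sigma>: "near_geodesic \<Omega> T \<sigma>" "\<sigma> 0 = z" "\<sigma> T = u" "0 \<le> T" "T < kobayashi_dist \<Omega> z u + 1"
      using near_geodesic_exists[OF \<Omega> hyp z _ zero_less_one order_refl] zu by (metis DiffD1)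
    have dc: "disc_curve \<Omega> \<sigma>" using \<sigma>(1) by (simp add: near_geodesic_def)
    \<comment> \<open>The end point \<open>u\<close> is outside \<open>U\<close>, hence outside
      every collar, so \<open>T\<close> itself serves as the time of having left.\<close>
    obtain s where s: "0 \<le> s" "s \<le> T" "\<sigma> s \<in> K"
      using K(3)[OF \<sigma>(1), of T] \<sigma> zu by (auto simp: collar_def)
    have "kobayashi_dist \<Omega> z (\<sigma> s) \<le> s"
      using kobayashi_dist_disc_curve_le[OF \<Omega> dc, of 0 s] \<sigma>(2) s by simp
    then show ?thesis
      using kobayashi_dist_triangle[OF \<Omega> z disc_curve_in[OF dc] p, of s] B[OF s(3)] s \<sigma>(5) by linarith
  qed
  then show ?thesis by (rule that)
qed

text \<open>The part of a near-geodesic after its passage through \<open>K\<close> already costs the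
  positive distance from \<open>K\<close> to the complement of \<open>U\<close>.\<close>

lemma kobayashi_dist_to_complement_pos:
  obtains r where "0 < r" "\<And>z u. z \<in> collar (2 * e) \<Longrightarrow> u \<in> \<Omega> - U \<Longrightarrow> r \<le> kobayashi_dist \<Omega> z u"
proof -
  obtain K where K: "compact K" "K \<subseteq> U"
    "\<And>T \<sigma> t. near_geodesic \<Omega> T \<sigma> \<Longrightarrow> \<sigma> 0 \<in> collar (2 * e) \<Longrightarrow> 0 \<le> t \<Longrightarrow> t \<le> T \<Longrightarrow> \<sigma> t \<notin> collar (3 * e) \<Longrightarrow>
      \<exists>s. 0 \<le> s \<and> s \<le> t \<and> \<sigma> s \<in> K \<and> (\<forall>x\<in>{0..s}. \<sigma> x \<in> collar (3 * e))"
    using leaving_near_geodesics_meet_compact[of "2 * e" "3 * e"] e by auto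
  obtain r where r: "0 < r" "\<And>q u. q \<in> K \<Longrightarrow> u \<in> \<Omega> - U \<Longrightarrow> r \<le> kobayashi_dist \<Omega> q u"
    using kobayashi_dist_compact_lower_bound[OF \<Omega> hyp K(1,2) open_domains(2) U_sub] by blast
  have "r \<le> kobayashi_dist \<Omega> z u" if zu: "z \<in> collar (2 * e)" "u \<in> \<Omega> - U" for z u
  proof (rule field_le_epsilon)
    fix \<epsilon> :: real assume "\<epsilon> > 0"
    then have \<epsilon>: "0 < min \<epsilon> 1" "min \<epsilon> 1 \<le> 1" by auto
    have z: "z \<in> \<Omega>" using zu U_sub by (auto simp: collar_def)
    obtain \<sigma> T where \<sigma>: "near_geodesic \<Omega> T \<sigma>" "\<sigma> 0 = z" "\<sigma> T = u" "0 \<le> T"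
      "T < kobayashi_dist \<Omega> z u + min \<epsilon> 1"
      using near_geodesic_exists[OF \<Omega> hyp z _ \<epsilon>] zu by (metis DiffD1)
    have dc: "disc_curve \<Omega> \<sigma>" using \<sigma>(1) by (simp add: near_geodesic_def)
    obtain s where s: "0 \<le> s" "s \<le> T" "\<sigma> s \<in> K"
      using K(3)[OF \<sigma>(1), of T] \<sigma> zu by (auto simp: collar_def)
    have "kobayashi_dist \<Omega> (\<sigma> s) u \<le> T - s"
      using kobayashi_dist_disc_curve_le[OF \<Omega> dc, of s T] \<sigma>(3) s by simp
    then show "r \<le> kobayashi_dist \<Omega> z u + \<epsilon>" using r(2)[OF s(3) zu(2)] s \<sigma>(5) by linarith
  qed
  with r(1) show ?thesis by (rule that)
qed

text \<open>The excess of length in \<open>U\<close> over \<open>T\<close> is bounded by an integral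
  that converges over the whole line, so \<open>B\<close> depends on neither \<open>T\<close> nor
  \<open>\<sigma>\<close>.\<close>

lemma near_geodesic_in_collar:
  obtains B where "\<And>T \<sigma>. 0 \<le> T \<Longrightarrow> near_geodesic \<Omega> T \<sigma> \<Longrightarrow> \<forall>t\<in>{0..T}. \<sigma> t \<in> collar (2 * e) \<Longrightarrow>
    kobayashi_dist U (\<sigma> 0) (\<sigma> T) \<le> T + B"
proof -
  obtain p where p: "p \<in> \<Omega>" using \<Omega> by (auto simp: cn_domain_def)
  obtain B where B: "\<And>z u. z \<in> collar (2 * e) \<Longrightarrow> u \<in> \<Omega> - U \<Longrightarrow>
    kobayashi_dist \<Omega> z p - B \<le> kobayashi_dist \<Omega> z u"
    using kobayashi_dist_to_complement_ge[OF p] by blast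
  obtain r where r: "0 < r" "\<And>z u. z \<in> collar (2 * e) \<Longrightarrow> u \<in> \<Omega> - U \<Longrightarrow> r \<le> kobayashi_dist \<Omega> z u"
    using kobayashi_dist_to_complement_pos by blast
  obtain A where A: "\<And>x. 1 / tanh (max r (\<bar>x\<bar> / 2 - (B + 1 / 2))) < 1 + A / (1 + x\<^sup>2)" "0 < A"
    using coth_max_bound[OF r(1)] by blast
  have "kobayashi_dist U (\<sigma> 0) (\<sigma> T) \<le> T + A * pi"
    if T: "0 \<le> T" and \<sigma>: "near_geodesic \<Omega> T \<sigma>" and col: "\<forall>t\<in>{0..T}. \<sigma> t \<in> collar (2 * e)" for T \<sigma>
  proof -
    have dc: "disc_curve \<Omega> \<sigma>" using \<sigma> by (simp add: near_geodesic_def)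
    note in\<Omega> = disc_curve_in[OF dc]
    have "continuous_on {0..T} ((\<lambda>(x, y). kobayashi_dist \<Omega> x y) \<circ> (\<lambda>t. (\<sigma> t, p)))"
      by (intro continuous_on_compose continuous_intros disc_curve_continuous_on[OF dc]
          continuous_on_subset[OF kobayashi_dist_continuous_on[OF \<Omega>]]) (use in\<Omega> p in auto)
    then have "continuous_on {0..T} (\<lambda>t. kobayashi_dist \<Omega> (\<sigma> t) p)" by (simp add: o_def)
    from continuous_attains_inf[OF _ _ this] T obtain t0 where t0: "t0 \<in> {0..T}"
      "\<And>t. t \<in> {0..T} \<Longrightarrow> kobayashi_dist \<Omega> (\<sigma> t0) p \<le> kobayashi_dist \<Omega> (\<sigma> t) p" by auto
    \<comment> \<open>Merges both lower bounds for the distance to the complement. As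
      \<open>t0\<close> is a time of least distance to \<open>p\<close>,
      \<open>\<bar>x - t0\<bar> - 1\<close> is at most twice the distance from
      \<open>\<sigma> x\<close> to \<open>p\<close>; hence the two halves.\<close>
    define s where "s = (\<lambda>x. max r (\<bar>x - t0\<bar> / 2 - (B + 1 / 2)))"
    \<comment> \<open>A primitive of the majorant in \<open>coth_max_bound\<close>; its
      \<open>arctan\<close> part varies by at most \<open>A * pi\<close>.\<close>
    define G where "G = (\<lambda>x. x + A * arctan (x - t0))"
    have far: "s x \<le> kobayashi_dist \<Omega> (\<sigma> x) u" if x: "0 \<le> x" "x \<le> T" and u: "u \<in> \<Omega> - U" for x u
    proof -
      have "\<bar>x - t0\<bar> - 1 \<le> kobayashi_dist \<Omega> (\<sigma> x) (\<sigma> t0)"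
        using \<sigma> x t0(1) by (simp add: near_geodesic_def)
      also have "\<dots> \<le> kobayashi_dist \<Omega> (\<sigma> x) p + kobayashi_dist \<Omega> (\<sigma> t0) p"
        using kobayashi_dist_triangle[OF \<Omega> in\<Omega> p in\<Omega>] kobayashi_hyperbolicD(1)[OF hyp] by metis
      also have "\<dots> \<le> 2 * kobayashi_dist \<Omega> (\<sigma> x) p" using t0(2)[of x] x by simp
      finally show ?thesis using B[of "\<sigma> x" u] r(2)[of "\<sigma> x" u] col x u by (simp add: s_def)
    qed
    have "kobayashi_dist U (\<sigma> 0) (\<sigma> T) \<le> G T - G 0"
    proof (rule kobayashi_dist_along_disc_curve[OF U U_sub dc T, where \<rho> = "\<lambda>x. tanh (s x)"])
      show "0 < tanh (s x) \<and> tanh (s x) \<le> 1" for x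
        using r(1) tanh_real_lt_1[of "s x"] by (simp add: s_def less_max_iff_disj)
      show "1 / tanh (s x) < 1 + A / (1 + (x - t0)\<^sup>2)" for x unfolding s_def by (rule A)
      show "(G has_real_derivative 1 + A / (1 + (x - t0)\<^sup>2)) (at x)" for x
        unfolding G_def by (auto intro!: derivative_eq_intros simp: divide_inverse)
      fix x \<phi> \<zeta> assume x: "0 \<le> x" "x \<le> T" and \<phi>: "\<phi> \<in> analytic_discs \<Omega>" "\<phi> 0 = \<sigma> x"
        and \<zeta>: "cmod \<zeta> < tanh (s x)"
      have z1: "cmod \<zeta> < 1" using \<zeta> tanh_real_lt_1[of "s x"] by linarith
      have "tanh (artanh (cmod \<zeta>)) < tanh (s x)" using \<zeta> z1 by (simp add: tanh_artanh_real)
      then have "artanh (cmod \<zeta>) < s x" by simp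
      moreover have "kobayashi_dist \<Omega> (\<sigma> x) (\<phi> \<zeta>) \<le> artanh (cmod \<zeta>)"
        using kobayashi_dist_le_poincare[OF \<phi>(1), of 0 \<zeta>] z1 \<phi>(2) by (simp add: poincare_dist_0)
      \<comment> \<open>The point \<open>\<phi> \<zeta>\<close> is closer to
        \<open>\<sigma> x\<close> than any point of \<open>\<Omega>\<close> outside \<open>U\<close>
        can be.\<close>
      ultimately show "\<phi> \<zeta> \<in> U"
        using far[OF x, of "\<phi> \<zeta>"] analytic_discsD(2)[OF \<phi>(1) z1] by fastforce
    qed
    also have "\<dots> = T + A * (arctan (T - t0) - arctan (- t0))" by (simp add: G_def algebra_simps)
    also have "\<dots> \<le> T + A * pi"
      using A(2) arctan_ubound[of "T - t0"] arctan_lbound[of "- t0"] by (intro add_left_mono mult_left_mono) linarith+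
    finally show ?thesis .
  qed
  then show ?thesis using that by blast
qed

text \<open>A near-geodesic that leaves the middle collar keeps only its two end pieces, up to
  points of \<open>K\<close>; the middle is replaced by a connection between these points, of
  bounded cost in \<open>U\<close>.\<close>

lemma kobayashi_dist_localization:
  "\<exists>B. \<forall>z\<in>collar 0. \<forall>w\<in>collar 0. kobayashi_dist U z w \<le> kobayashi_dist \<Omega> z w + B"
proof -
  obtain B where B: "\<And>T \<sigma>. 0 \<le> T \<Longrightarrow> near_geodesic \<Omega> T \<sigma> \<Longrightarrow> \<forall>t\<in>{0..T}. \<sigma> t \<in> collar (2 * e) \<Longrightarrow>
    kobayashi_dist U (\<sigma> 0) (\<sigma> T) \<le> T + B"
    using near_geodesic_in_collar by blast
  obtain K where K: "compact K" "K \<subseteq> U"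
    "\<And>T \<sigma> t. near_geodesic \<Omega> T \<sigma> \<Longrightarrow> \<sigma> 0 \<in> collar 0 \<Longrightarrow> 0 \<le> t \<Longrightarrow> t \<le> T \<Longrightarrow> \<sigma> t \<notin> collar (2 * e) \<Longrightarrow>
      \<exists>s. 0 \<le> s \<and> s \<le> t \<and> \<sigma> s \<in> K \<and> (\<forall>x\<in>{0..s}. \<sigma> x \<in> collar (2 * e))"
    using leaving_near_geodesics_meet_compact[of 0 "2 * e"] e by auto
  have "continuous_on (K \<times> K) (\<lambda>(x, y). kobayashi_dist U x y)"
    by (rule continuous_on_subset[OF kobayashi_dist_continuous_on[OF U]]) (use K in auto)
  then have "bounded ((\<lambda>(x, y). kobayashi_dist U x y) ` (K \<times> K))"
    using K(1) by (intro compact_imp_bounded compact_continuous_image compact_Times) auto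
  then obtain D where D: "\<And>x y. x \<in> K \<Longrightarrow> y \<in> K \<Longrightarrow> kobayashi_dist U x y \<le> D"
    unfolding bounded_iff by (force simp: abs_le_iff)
  \<comment> \<open>The summands pay for \<open>T\<close> exceeding the distance, for two end pieces
    and for the connection within \<open>K\<close>; absolute values let one constant serve both
    cases.\<close>
  have "kobayashi_dist U z w \<le> kobayashi_dist \<Omega> z w + (1 + 2 * \<bar>B\<bar> + \<bar>D\<bar>)"
    if zw: "z \<in> collar 0" "w \<in> collar 0" for z w
  proof -
    have U0: "z \<in> U" "w \<in> U" using zw by (auto simp: collar_def)
    then obtain \<sigma> T where \<sigma>: "near_geodesic \<Omega> T \<sigma>" "\<sigma> 0 = z" "\<sigma> T = w" "0 \<le> T"
      "T < kobayashi_dist \<Omega> z w + 1"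
      using near_geodesic_exists[OF \<Omega> hyp _ _ zero_less_one order_refl, of z w] U_sub by (metis subsetD)
    show ?thesis
    proof (cases "\<forall>t\<in>{0..T}. \<sigma> t \<in> collar (2 * e)")
      case True
      then show ?thesis using B[OF \<sigma>(4,1)] \<sigma> by simp
    next
      case False
      then obtain t where t: "0 \<le> t" "t \<le> T" "\<sigma> t \<notin> collar (2 * e)" by auto
      obtain s1 where s1: "0 \<le> s1" "s1 \<le> t" "\<sigma> s1 \<in> K" "\<forall>x\<in>{0..s1}. \<sigma> x \<in> collar (2 * e)"
        using K(3)[OF \<sigma>(1) _ t] \<sigma> zw by auto
      \<comment> \<open>The reversed curve is outside the collar at time \<open>T - t\<close>. Thus
        \<open>s1 \<le> t \<le> T - s2\<close>, and the two end pieces together take at most the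
        time \<open>T\<close>.\<close>
      obtain s2 where s2: "0 \<le> s2" "s2 \<le> T - t" "\<sigma> (T - s2) \<in> K" "\<forall>x\<in>{0..s2}. \<sigma> (T - x) \<in> collar (2 * e)"
        using K(3)[OF near_geodesic_reverse[OF \<sigma>(1)], of "T - t"] \<sigma> zw t by auto
      have 1: "kobayashi_dist U z (\<sigma> s1) \<le> s1 + B"
        using B[OF s1(1) _ s1(4)] near_geodesic_shift[OF \<sigma>(1), of 0 s1] s1 t \<sigma>(2) by simp
      have "\<sigma> (T - s2 + x) \<in> collar (2 * e)" if "x \<in> {0..s2}" for x
        using bspec[OF s2(4), of "s2 - x"] that by (simp add: algebra_simps)
      then have 2: "kobayashi_dist U (\<sigma> (T - s2)) w \<le> s2 + B"
        using B[OF s2(1) near_geodesic_shift[OF \<sigma>(1), of "T - s2" s2]] s2 t \<sigma>(3) by simp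
      have k: "\<sigma> s1 \<in> U" "\<sigma> (T - s2) \<in> U" using s1 s2 K(2) by auto
      show ?thesis
        using 1 2 D[OF s1(3) s2(3)] kobayashi_dist_triangle[OF U U0(1) k(1) U0(2)]
          kobayashi_dist_triangle[OF U k U0(2)] s1 s2 \<sigma>(5) by linarith
    qed
  qed
  then show ?thesis by blast
qed

end

theorem lemma3p21:
  fixes \<Omega> U W :: "(complex ^ 'n) set" and lam :: real
  assumes "cn_domain \<Omega>" and "kobayashi_hyperbolic \<Omega>"
    and "cn_domain U" and "U \<subseteq> \<Omega>"
    and "lam \<ge> 1"
    and "\<And>\<zeta> \<eta>. \<lbrakk>\<zeta> \<in> frontier U \<inter> frontier \<Omega>; \<eta> \<in> frontier U \<inter> frontier \<Omega>; \<zeta> \<noteq> \<eta>\<rbrakk>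
           \<Longrightarrow> visible_pair \<Omega> lam \<zeta> \<eta>"
    and "open W" and "W \<subseteq> U"
    and "compact (closure W)"
    and "closure W \<subseteq> (U \<union> frontier \<Omega>) - closure (frontier U \<inter> \<Omega>)"
  shows "\<exists>C::real. \<forall>z\<in>W. \<forall>w\<in>W. kobayashi_dist U z w \<le> kobayashi_dist \<Omega> z w + C"
proof (cases "W = {}")
  case False
  then have ne: "closure W \<noteq> {}" by simp
  obtain d where d: "d > 0" "{x. infdist x (closure W) \<le> d} \<subseteq> - closure (frontier U \<inter> \<Omega>)"
    using compact_in_open_separated[OF ne assms(9), of "- closure (frontier U \<inter> \<Omega>)"] assms(10) by auto
  have "open U" using assms(3) by (simp add: cn_domain_def)
  \<comment> \<open>With \<open>e = d / 3\<close> the widest collar has width \<open>d\<close> and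
    still avoids the closure of \<open>frontier U \<inter> \<Omega>\<close>.\<close>
  interpret visible_subdomain \<Omega> U "closure W" lam "d / 3"
  proof
    fix x assume x: "x \<in> closure U" "x \<in> \<Omega>" "infdist x (closure W) \<le> 3 * (d / 3)"
    then have "x \<notin> frontier U \<inter> \<Omega>" using d(2) closure_subset[of "frontier U \<inter> \<Omega>"] by auto
    then show "x \<in> U" using x \<open>open U\<close> by (auto simp: frontier_def interior_open)
  qed (use assms ne d in auto)
  have "W \<subseteq> collar 0" using assms(8) closure_subset[of W] by (auto simp: collar_def)
  then show ?thesis using kobayashi_dist_localization by blast
qed simp

end
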